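(* Let $H_1,\dots,H_n$ be fixed Hermitian matrices of common dimension $d$, let $\gamma_1,\dots,\gamma_n$ be independent standard normal random variables, and let $X := \sum_{i=1}^n \gamma_i H_i$. For $q \ge 1$ define $$\sigma_q(X) := \left\| \Big( \sum_{i=1}^n H_i^2 \Big)^{1/2} \right\|_q \quad\text{and}\quad w_q(X) := \max_{Q_1,Q_2,Q_3} \left\| \, \Big| \sum_{i,j=1}^n H_i Q_1 H_j Q_2 H_i Q_3 H_j \Big|^{1/4} \right\|_q ,$$ where the maximum ranges over all triples $(Q_1,Q_2,Q_3)$ of $d\times d$ unitary matrices. Then, for each integer $p \geq 3$, $$\big( \mathbb{E} \| X \|_{2p}^{2p} \big)^{1/(2p)} \;\le\; 3 \,(2p-5)^{1/4} \cdot \sigma_{2p}(X) \;+\; \sqrt{2p-4} \cdot w_{2p}(X).$$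
   Context: Matrices have complex entries. For a matrix $B$, $|B| := (B^*B)^{1/2}$, where $B^*$ is the conjugate transpose. Powers of a positive-semidefinite matrix are defined by applying the power to each eigenvalue while keeping the eigenvectors. The Schatten $q$-norm is $\|B\|_q := (\operatorname{tr} |B|^q)^{1/q}$ for $q \ge 1$. *)

theory Defs
  imports "HOL-Probability.Probability"
begin

definition cadjoint :: "complex^'n^'m \<Rightarrow> complex^'m^'n" where
  "cadjoint A = (\<chi> i j. cnj (A $ j $ i))"

definition hermitian_matrix :: "complex^'n^'n \<Rightarrow> bool" where
  "hermitian_matrix A \<longleftrightarrow> cadjoint A = A"

definition unitary_matrix :: "complex^'n^'n \<Rightarrow> bool" where
  "unitary_matrix Q \<longleftrightarrow> cadjoint Q ** Q = mat 1 \<and> Q ** cadjoint Q = mat 1"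

text \<open>
  The power \<open>A\<^sup>r\<close> of a positive-semidefinite matrix: every eigenvector of \<open>A\<close> for the
  eigenvalue \<open>l\<close> is an eigenvector of \<open>A\<^sup>r\<close> for the eigenvalue \<open>l\<^sup>r\<close>. Such a matrix exists
  and is unique because the eigenvectors of a Hermitian matrix span the whole space and its
  eigenvalues are real; the vector \<open>v = 0\<close> and the numbers \<open>l\<close> that are not eigenvalues impose
  no condition. Nothing is intended when \<open>A\<close> is not positive semidefinite.
  The exponent is meant to be positive; \<open>0 powr r = 0\<close>.
\<close>
definition psd_power :: "complex^'n^'n \<Rightarrow> real \<Rightarrow> complex^'n^'n" where
  "psd_power A r =
     (THE C. \<forall>(l::real) v. A *v v = l *\<^sub>R v \<longrightarrow> C *v v = (l powr r) *\<^sub>R v)"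

definition matrix_abs :: "complex^'n^'n \<Rightarrow> complex^'n^'n" where
  "matrix_abs B = psd_power (cadjoint B ** B) (1/2)"

text \<open>
  The trace below is a non-negative real number; \<open>Re\<close> only changes the type.
\<close>
definition schatten_norm :: "real \<Rightarrow> complex^'n^'n \<Rightarrow> real" where
  "schatten_norm q B = Re (trace (psd_power (matrix_abs B) q)) powr (1/q)"

definition matrix_sigma :: "real \<Rightarrow> nat \<Rightarrow> (nat \<Rightarrow> complex^'d^'d) \<Rightarrow> real" where
  "matrix_sigma q n H = schatten_norm q (psd_power (\<Sum>i\<in>{1..n}. H i ** H i) (1/2))"

text \<open>
  The supremum is a maximum: the unitary matrices form a compact set on which the expression
  is continuous.
\<close>
definition matrix_w :: "real \<Rightarrow> nat \<Rightarrow> (nat \<Rightarrow> complex^'d^'d) \<Rightarrow> real" where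
  "matrix_w q n H =
     (SUP (Q1, Q2, Q3) \<in> Collect unitary_matrix \<times> Collect unitary_matrix \<times> Collect unitary_matrix.
        schatten_norm q (psd_power (matrix_abs
          (\<Sum>i\<in>{1..n}. \<Sum>j\<in>{1..n}. H i ** Q1 ** H j ** Q2 ** H i ** Q3 ** H j)) (1/4)))"

end

theory Submission
  imports Defs "HOL-Complex_Analysis.Conformal_Mappings"
begin

text \<open>
  Write \<open>T = E tr X\<^sup>2\<^sup>p\<close> and \<open>V = \<Sum>\<^sub>i H\<^sub>i\<^sup>2\<close>. Gaussian integration by parts turns \<open>T\<close> into the sum over
  \<open>r \<le> 2p - 2\<close> of the terms \<open>E \<Sum>\<^sub>i tr H\<^sub>i X\<^sup>r H\<^sub>i X\<^sup>2\<^sup>p\<^sup>-\<^sup>2\<^sup>-\<^sup>r\<close>. In an eigenbasis of \<open>X\<close> these are sums of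
  monomials with non-negative weights, so elementary inequalities reduce all of them to the terms
  with \<open>r = 0\<close> (three times) and \<open>r = 2\<close> (\<open>2p - 4\<close> times). The first one is \<open>E tr V X\<^sup>2\<^sup>p\<^sup>-\<^sup>2\<close>, which
  Hoelder's inequality bounds. In the second one, \<open>X\<^sup>2 = X X\<close> admits another integration by parts.
  This produces \<open>E \<Sum>\<^sub>i tr H\<^sub>i V H\<^sub>i X\<^sup>2\<^sup>p\<^sup>-\<^sup>4\<close>, again bounded by Hoelder's inequality, and \<open>2p - 4\<close> crossing
  terms \<open>E \<Sum>\<^sub>i\<^sub>j tr H\<^sub>i H\<^sub>j X H\<^sub>i X\<^sup>r H\<^sub>j X\<^sup>s\<close> with \<open>1 + r + s = 2p - 4\<close>. Complex interpolation moves all powers of \<open>X\<close>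
  of a crossing term into one place, at the price of unitary factors in the other places, and there
  the trace duality of Schatten norms gives the bound by \<open>w\<close>. The result is a quadratic inequality
  for \<open>T\<^sup>1\<^sup>/\<^sup>p\<close>.
\<close>

section \<open>Matrices over the complex numbers and the spectral theorem\<close>

text \<open>Bounding every term of the first integration by parts by the one with r = 0 would only
  give a multiple of \<sigma> of order sqrt p. Comparing with r = 2 keeps two factors X between two
  copies of H_i, so that a second integration by parts exposes the interleaved pattern H_i, H_j,
  H_i, H_j on which w depends. The exponent of comparison is even because odd powers of eigenvalues
  carry signs. The obstacle is that the powers of X in a crossing term do not commute with the
  matrices that separate them, while reordering would destroy the pattern. Interpolation keeps it:
  on the boundary of the strip powers of X turn into unitary factors, which is why w maximises over
  unitary matrices. Apart from the integrations by parts all estimates are pointwise in \<omega>,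
  with powers below 1 of tr X^(2p), so Jensen's inequality brings in T. With m = T^(1/(2p)) and b =
  2p - 4 the outcome is m^4 \<le> 3 \<sigma>^2 m^2 + b \<sigma>^4 + b^2 w^4. Here \<sigma>^4 has
  only the first power of b: hence a fourth root in front of \<sigma> and a square root in front of
  w.\<close>

lemma bounded_bilinear_matrix_mult:
  "bounded_bilinear ((**) :: complex^'n^'m \<Rightarrow> complex^'k^'n \<Rightarrow> complex^'k^'m)"
  unfolding bilinear_conv_bounded_bilinear[symmetric] bilinear_def
  by (auto intro!: linearI simp: vec_eq_iff matrix_matrix_mult_def sum.distrib algebra_simps
      scaleR_sum_right)

interpretation mmult: bounded_bilinear "(**) :: complex^'n^'m \<Rightarrow> complex^'k^'n \<Rightarrow> complex^'k^'m"
  by (rule bounded_bilinear_matrix_mult)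

lemma cadjoint_component [simp]: "cadjoint A $ i $ j = cnj (A $ j $ i)"
  by (simp add: cadjoint_def)

lemma cadjoint_cadjoint [simp]: "cadjoint (cadjoint A) = A"
  by (simp add: vec_eq_iff)

lemma cadjoint_mult: "cadjoint (A ** B) = cadjoint B ** cadjoint A"
  by (simp add: vec_eq_iff matrix_matrix_mult_def mult.commute)

lemma cadjoint_mat1 [simp]: "cadjoint (mat 1) = mat 1"
  by (simp add: vec_eq_iff mat_def)

lemma cadjoint_sum: "cadjoint (\<Sum>i\<in>I. A i) = (\<Sum>i\<in>I. cadjoint (A i))"
  by (simp add: vec_eq_iff)

lemma trace_sum: "trace (\<Sum>i\<in>I. A i) = (\<Sum>i\<in>I. trace (A i))"
  unfolding trace_def by (simp add: sum.swap[of _ I])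

lemma bounded_linear_Re_trace: "bounded_linear (\<lambda>A :: complex^'n^'n. Re (trace A))"
  by (rule linear_conv_bounded_linear[THEN iffD1], rule linearI)
    (auto simp: trace_def sum.distrib scaleR_sum_right sum_distrib_left)

section \<open>Diagonal and unitary matrices\<close>

definition diagm :: "('n \<Rightarrow> complex) \<Rightarrow> complex^'n^'n" where
  "diagm f = (\<chi> i j. if i = j then f i else 0)"

text \<open>The normal form used throughout: for unitary U, products, powers and traces act on f
  alone, and so do absolute values and Schatten norms when f is real.\<close>

definition conj_diag :: "complex^'n^'n \<Rightarrow> ('n \<Rightarrow> complex) \<Rightarrow> complex^'n^'n" where
  "conj_diag U f = U ** diagm f ** cadjoint U"

primrec mpow :: "complex^'n^'n \<Rightarrow> nat \<Rightarrow> complex^'n^'n" where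
  "mpow A 0 = mat 1"
| "mpow A (Suc k) = A ** mpow A k"

lemma mult_diagm_component [simp]: "(A ** diagm f) $ i $ j = A $ i $ j * f j"
  by (simp add: matrix_matrix_mult_def diagm_def if_distrib if_distribR cong: if_cong)

lemma diagm_mult_component [simp]: "(diagm f ** A) $ i $ j = f i * A $ i $ j"
  by (simp add: matrix_matrix_mult_def diagm_def if_distrib if_distribR cong: if_cong)

lemma diagm_mult: "diagm f ** diagm g = diagm (\<lambda>i. f i * g i)"
  by (simp add: vec_eq_iff) (simp add: diagm_def)

lemma cadjoint_diagm: "cadjoint (diagm f) = diagm (\<lambda>i. cnj (f i))"
  by (simp add: vec_eq_iff) (simp add: diagm_def)

lemma diagm_one: "diagm (\<lambda>i. 1) = mat 1"
  by (simp add: diagm_def mat_def)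

lemma trace_diagm: "trace (diagm f) = sum f UNIV"
  by (simp add: trace_def diagm_def)

lemma trace_rot: "trace (A ** B ** C) = trace (B ** C ** (A :: complex^'n^'n))"
  by (metis matrix_mul_assoc trace_mul_sym)

lemma unitary_mult: "unitary_matrix A \<Longrightarrow> unitary_matrix B \<Longrightarrow> unitary_matrix (A ** B)"
  unfolding unitary_matrix_def cadjoint_mult by (metis matrix_mul_assoc matrix_mul_lid)

lemma unitary_cadjoint: "unitary_matrix A \<Longrightarrow> unitary_matrix (cadjoint A)"
  by (simp add: unitary_matrix_def)

lemma unitary_mat1: "unitary_matrix (mat 1)"
  by (simp add: unitary_matrix_def)

lemma unitary_diagm: "(\<And>i. cmod (f i) = 1) \<Longrightarrow> unitary_matrix (diagm f)"
  unfolding unitary_matrix_def cadjoint_diagm diagm_mult diagm_one[symmetric]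
  by (simp add: complex_norm_square[symmetric] mult.commute[of "cnj _"])

lemma unitaryD:
  assumes "unitary_matrix U"
  shows "cadjoint U ** U = mat 1" "U ** cadjoint U = mat 1"
    "cadjoint U ** (U ** A) = A" "U ** (cadjoint U ** A) = A"
  using assms unfolding unitary_matrix_def by (simp_all add: matrix_mul_assoc)

lemma conj_diag_mult:
  assumes "unitary_matrix U"
  shows "conj_diag U f ** conj_diag U g = conj_diag U (\<lambda>i. f i * g i)"
  unfolding conj_diag_def diagm_mult[symmetric]
  by (simp add: matrix_mul_assoc[symmetric] unitaryD(3)[OF assms])

lemma conj_diag_one: "unitary_matrix U \<Longrightarrow> conj_diag U (\<lambda>i. 1) = mat 1"
  by (simp add: conj_diag_def diagm_one unitaryD)

lemma mpow_conj_diag: "unitary_matrix U \<Longrightarrow> mpow (conj_diag U f) k = conj_diag U (\<lambda>i. f i ^ k)"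
  by (induction k) (simp_all add: conj_diag_one conj_diag_mult)

lemma cadjoint_conj_diag: "cadjoint (conj_diag U f) = conj_diag U (\<lambda>i. cnj (f i))"
  by (simp add: conj_diag_def cadjoint_mult cadjoint_diagm matrix_mul_assoc)

lemma trace_conj_diag: "unitary_matrix U \<Longrightarrow> trace (conj_diag U f) = sum f UNIV"
  unfolding conj_diag_def by (subst trace_mul_sym) (simp add: unitaryD trace_diagm matrix_mul_assoc)

section \<open>The complex inner product and eigenvectors of Hermitian matrices\<close>

text \<open>The Euclidean inner product of \<open>complex^'n\<close> is only the real part of this
  form, and orthogonality in the real sense would not make a matrix of eigenvectors unitary.\<close>

definition cinner :: "complex^'n \<Rightarrow> complex^'n \<Rightarrow> complex" where
  "cinner x y = (\<Sum>i\<in>UNIV. cnj (x $ i) * y $ i)"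

lemma Re_cinner: "Re (cinner x y) = x \<bullet> y"
  by (simp add: cinner_def inner_vec_def inner_complex_def)

lemma cinner_add_right: "cinner x (y + z) = cinner x y + cinner x z"
  by (simp add: cinner_def sum.distrib algebra_simps)

lemma cinner_scaleR_right: "cinner x (c *\<^sub>R y) = c *\<^sub>R cinner x y"
  by (simp add: cinner_def scaleR_sum_right)

lemma cinner_scaleR_left: "cinner (c *\<^sub>R x) y = c *\<^sub>R cinner x y"
  by (simp add: cinner_def scaleR_sum_right)

lemma cinner_scale_left: "cinner (c *s x) y = cnj c * cinner x y"
  by (simp add: cinner_def sum_distrib_left mult.assoc)

lemma cinner_commute: "cinner y x = cnj (cinner x y)"
  by (simp add: cinner_def mult.commute)

lemma cinner_matrix: "cinner (A *v x) y = cinner x (cadjoint A *v y)"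
proof -
  have "cinner (A *v x) y = (\<Sum>i\<in>UNIV. \<Sum>j\<in>UNIV. cnj (A $ i $ j) * cnj (x $ j) * y $ i)"
    by (simp add: cinner_def matrix_vector_mult_def sum_distrib_right)
  also have "\<dots> = (\<Sum>j\<in>UNIV. \<Sum>i\<in>UNIV. cnj (A $ i $ j) * cnj (x $ j) * y $ i)"
    by (rule sum.swap)
  also have "\<dots> = cinner x (cadjoint A *v y)"
    by (simp add: cinner_def matrix_vector_mult_def sum_distrib_left mult.assoc mult.left_commute)
  finally show ?thesis .
qed

lemma matrix_vector_scaleR: "A *v (c *\<^sub>R x) = c *\<^sub>R (A *v (x :: complex^'n))"
  by (simp add: vec_eq_iff matrix_vector_mult_def scaleR_sum_right)

lemma cinner_self: "norm x = 1 \<Longrightarrow> cinner x x = 1"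
proof -
  assume "norm x = 1"
  have "Im (cinner x x) = 0" by (simp add: cinner_def mult.commute)
  moreover have "Re (cinner x x) = 1"
    using \<open>norm x = 1\<close> by (simp add: Re_cinner dot_square_norm)
  ultimately show ?thesis by (simp add: complex_eq_iff)
qed

text \<open>A maximiser of the Rayleigh quotient on an invariant subspace is an eigenvector.\<close>
lemma hermitian_eigenvector_in_subspace:
  fixes A :: "complex^'n^'n"
  assumes A: "hermitian_matrix A" and W: "subspace W" and inv: "\<And>x. x \<in> W \<Longrightarrow> A *v x \<in> W"
    and z: "z \<in> W" "z \<noteq> 0"
  shows "\<exists>v\<in>W. norm v = 1 \<and> (\<exists>l::real. A *v v = l *\<^sub>R v)"
proof -
  define q where "q = (\<lambda>x. x \<bullet> (A *v x))"
  have sym: "(A *v x) \<bullet> y = x \<bullet> (A *v y)" for x y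
    using cinner_matrix[of A x y] A by (simp add: Re_cinner[symmetric] hermitian_matrix_def)
  have "closed W" by (rule closed_subspace[OF W])
  then have cpt: "compact (W \<inter> sphere 0 1)" by (simp add: closed_Int_compact)
  have "(1 / norm z) *\<^sub>R z \<in> W \<inter> sphere 0 1"
    using z by (simp add: subspace_scale[OF W])
  then have ne: "W \<inter> sphere 0 1 \<noteq> {}" by blast
  have cont: "continuous_on (W \<inter> sphere 0 1) q"
    unfolding q_def by (intro continuous_intros linear_continuous_on
        linear_conv_bounded_linear[THEN iffD1]) simp
  obtain v where v: "v \<in> W" "norm v = 1" and max: "\<And>y. y \<in> W \<Longrightarrow> norm y = 1 \<Longrightarrow> q y \<le> q v"
    using continuous_attains_sup[OF cpt ne cont] by auto
  define l where "l = q v"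
  have max': "q y \<le> l * (norm y)\<^sup>2" if "y \<in> W" for y
  proof (cases "y = 0")
    case True
    then show ?thesis by (simp add: q_def)
  next
    case False
    have "q ((1 / norm y) *\<^sub>R y) \<le> l"
      unfolding l_def using False that by (intro max) (auto simp: subspace_scale[OF W])
    moreover have "q ((1 / norm y) *\<^sub>R y) = q y / (norm y)\<^sup>2"
      by (simp add: q_def matrix_vector_scaleR power2_eq_square)
    ultimately show ?thesis using False by (simp add: field_simps)
  qed
  \<comment> \<open>The residual of the eigenvalue equation is orthogonal to v. Moving v in its
    direction raises the quotient to first order unless the residual is 0; \<open>ineq\<close>
    records this along the line v + t w.\<close>
  define w where "w = A *v v - l *\<^sub>R v"
  have vv: "v \<bullet> v = 1" using v by (simp add: dot_square_norm)
  have wW: "w \<in> W" unfolding w_def using v inv W by (simp add: subspace_diff subspace_scale)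
  have wv: "w \<bullet> v = 0"
    using vv by (simp add: w_def inner_diff_left inner_diff_right l_def q_def inner_commute)
  have wA: "w \<bullet> (A *v v) = w \<bullet> w"
    using wv by (simp add: w_def inner_diff_right inner_diff_left)
  have ineq: "2 * t * (w \<bullet> w) + t\<^sup>2 * (q w - l * (w \<bullet> w)) \<le> 0" for t :: real
  proof -
    have "q (v + t *\<^sub>R w) \<le> l * (norm (v + t *\<^sub>R w))\<^sup>2"
      using v wW W by (intro max') (simp add: subspace_add subspace_scale)
    moreover have "(norm (v + t *\<^sub>R w))\<^sup>2 = 1 + t\<^sup>2 * (w \<bullet> w)"
      unfolding power2_norm_eq_inner using vv wv
      by (simp add: inner_add_left inner_add_right inner_commute[of v w] power2_eq_square)
    moreover have "q (v + t *\<^sub>R w) = l + 2 * t * (w \<bullet> w) + t\<^sup>2 * q w"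
      using wA sym[of v w]
      by (simp add: q_def l_def matrix_vector_right_distrib matrix_vector_scaleR
          inner_add_left inner_add_right power2_eq_square inner_commute[of "A *v v"] algebra_simps)
    ultimately show ?thesis by (simp add: algebra_simps)
  qed
  have "w \<bullet> w \<le> 0"
  proof (rule ccontr)
    assume "\<not> w \<bullet> w \<le> 0"
    then have pos: "w \<bullet> w > 0" by linarith
    define a where "a = w \<bullet> w"
    define b where "b = \<bar>q w - l * (w \<bullet> w)\<bar>"
    \<comment> \<open>Any positive t with t * b < 2 * a contradicts \<open>ineq\<close>; the summand
      1 keeps the denominator positive when b = 0.\<close>
    define t where "t = a / (b + 1)"
    have "a > 0" "b \<ge> 0" using pos by (auto simp: a_def b_def)
    then have "t > 0" and "t * b < 2 * a"
      by (auto simp: t_def divide_simps algebra_simps intro!: add_pos_pos add_nonneg_pos)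
    have "- b \<le> q w - l * (w \<bullet> w)" by (simp add: b_def)
    then have "t\<^sup>2 * (- b) \<le> t\<^sup>2 * (q w - l * (w \<bullet> w))" by (intro mult_left_mono) auto
    with ineq[of t] have "t * (2 * a - t * b) \<le> 0"
      by (simp add: a_def power2_eq_square algebra_simps)
    with \<open>t > 0\<close> \<open>t * b < 2 * a\<close> show False by (simp add: mult_le_0_iff)
  qed
  then have "w = 0" by (metis inner_eq_zero_iff inner_ge_zero order_antisym)
  then show ?thesis using v by (auto simp: w_def)
qed

text \<open>Deflation by induction on I: the orthogonal complement of the eigenvectors already found
  is invariant under A and contains a further unit eigenvector. With subsets of 'n as index sets, I
  = UNIV yields a full basis.\<close>

lemma hermitian_orthonormal_eigenvectors:
  fixes A :: "complex^'n^'n" and I :: "'n set"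
  assumes A: "hermitian_matrix A"
  shows "\<exists>u (l :: 'n \<Rightarrow> real). \<forall>i\<in>I. A *v u i = l i *\<^sub>R u i \<and>
    (\<forall>j\<in>I. cinner (u i) (u j) = (if i = j then 1 else 0))"
  using finite[of I]
proof (induction I rule: finite_induct)
  case empty
  show ?case by simp
next
  case (insert k I)
  then obtain u l where eig: "\<And>i. i \<in> I \<Longrightarrow> A *v u i = (l i :: real) *\<^sub>R u i"
    and on: "\<And>i j. i \<in> I \<Longrightarrow> j \<in> I \<Longrightarrow> cinner (u i) (u j) = (if i = j then 1 else 0)"
    by blast
  define W where "W = {x. \<forall>i\<in>I. cinner (u i) x = 0}"
  have W: "subspace W"
    by (auto simp: W_def subspace_def cinner_add_right cinner_scaleR_right) (simp add: cinner_def)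
  have inv: "A *v x \<in> W" if "x \<in> W" for x
  proof -
    have "cinner (u i) (A *v x) = 0" if "i \<in> I" for i
      using cinner_matrix[of A "u i" x] A eig[OF that] that \<open>x \<in> W\<close>
      by (simp add: hermitian_matrix_def cinner_scaleR_left W_def)
    then show ?thesis by (simp add: W_def)
  qed
  \<comment> \<open>Complex orthogonality to \<open>u i\<close> means real orthogonality to
    \<open>u i\<close> and to \<i> times it. Over the reals these are at most 2 |I| vectors in a
    space of dimension 2 CARD('n), so a nonzero orthogonal vector is left.\<close>
  define S where "S = u ` I \<union> (\<lambda>i. \<i> *s u i) ` I"
  have "card S \<le> card (u ` I) + card ((\<lambda>i. \<i> *s u i) ` I)"
    unfolding S_def by (rule card_Un_le)
  also have "\<dots> \<le> card I + card I" by (intro add_mono card_image_le) auto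
  also have "\<dots> < 2 * CARD('n)"
  proof -
    have "I \<subset> UNIV" using insert.hyps by blast
    then have "card I < CARD('n)" by (intro psubset_card_mono) auto
    then show ?thesis by simp
  qed
  also have "\<dots> = DIM(complex^'n)" by simp
  finally have "card S < DIM(complex^'n)" .
  moreover have "dim S \<le> card S" by (rule dim_le_card') (simp add: S_def)
  ultimately have "dim S < DIM(complex^'n)" by linarith
  then obtain z where z: "z \<noteq> 0" "\<And>y. y \<in> span S \<Longrightarrow> orthogonal z y"
    using orthogonal_to_subspace_exists by blast
  have "cinner (u i) z = 0" if "i \<in> I" for i
  proof -
    have "orthogonal z (u i)" "orthogonal z (\<i> *s u i)"
      using that by (auto intro!: z span_base simp: S_def)
    then have "Re (cinner (u i) z) = 0" "Re (cinner (\<i> *s u i) z) = 0"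
      by (simp_all add: Re_cinner orthogonal_def inner_commute)
    then show ?thesis by (simp add: cinner_scale_left complex_eq_iff)
  qed
  then have "z \<in> W" by (simp add: W_def)
  from hermitian_eigenvector_in_subspace[OF A W inv this z(1)]
  obtain v m where v: "v \<in> W" "norm v = 1" "A *v v = (m :: real) *\<^sub>R v" by blast
  have vu: "cinner (u i) v = 0" "cinner v (u i) = 0" if "i \<in> I" for i
    using v(1) that cinner_commute[of v "u i"] by (auto simp: W_def)
  show ?case
    by (rule exI[of _ "u(k := v)"], rule exI[of _ "l(k := m)"])
      (use insert.hyps eig on v vu in \<open>auto simp: cinner_self\<close>)
qed

theorem hermitian_spectral:
  fixes A :: "complex^'n^'n"
  assumes A: "hermitian_matrix A"
  obtains U and l :: "'n \<Rightarrow> real" where "unitary_matrix U" "A = conj_diag U (\<lambda>i. of_real (l i))"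
proof -
  obtain u and l :: "'n \<Rightarrow> real" where eig: "\<And>i. A *v u i = l i *\<^sub>R u i"
    and on: "\<And>i j. cinner (u i) (u j) = (if i = j then 1 else 0)"
    using hermitian_orthonormal_eigenvectors[OF A, of UNIV] by auto
  define U :: "complex^'n^'n" where "U = (\<chi> i j. u j $ i)"
  have "cadjoint U ** U = mat 1"
    using on by (simp add: vec_eq_iff matrix_matrix_mult_def U_def mat_def cinner_def)
  then have U: "unitary_matrix U"
    unfolding unitary_matrix_def using matrix_left_right_inverse by blast
  have "A ** U = U ** diagm (\<lambda>i. of_real (l i))"
  proof -
    have "(A ** U) $ i $ j = U $ i $ j * of_real (l j)" for i j
    proof -
      have "(A *v u j) $ i = of_real (l j) * u j $ i"
        unfolding eig vector_scaleR_component by (rule scaleR_conv_of_real)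
      then show ?thesis
        by (simp add: matrix_matrix_mult_def matrix_vector_mult_def U_def mult.commute)
    qed
    then show ?thesis by (simp add: vec_eq_iff)
  qed
  then have "A = conj_diag U (\<lambda>i. of_real (l i))"
    unfolding conj_diag_def using unitaryD(2)[OF U] by (metis matrix_mul_assoc matrix_mul_rid)
  with U show thesis by (rule that)
qed

section \<open>Powers, absolute values and Schatten norms\<close>

abbreviation conj_rdiag :: "complex^'n^'n \<Rightarrow> ('n \<Rightarrow> real) \<Rightarrow> complex^'n^'n" where
  "conj_rdiag U l \<equiv> conj_diag U (\<lambda>i. complex_of_real (l i))"

lemma diagm_vector_component [simp]: "(diagm f *v x) $ i = f i * x $ i"
  by (simp add: matrix_vector_mult_def diagm_def if_distrib if_distribR cong: if_cong)

lemma scaleR_vector_component: "(c *\<^sub>R x) $ i = complex_of_real c * x $ i"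
  unfolding vector_scaleR_component by (rule scaleR_conv_of_real)

lemma conj_diag_vector: "conj_diag U f *v x = U *v (diagm f *v (cadjoint U *v x))"
  by (simp add: conj_diag_def matrix_vector_mul_assoc matrix_mul_assoc)

text \<open>In the coordinates y = \<open>cadjoint U *v x\<close>, an eigenvector for m is a vector
  supported on the indices with l i = m, and there the new diagonal matrix acts as the scalar m powr
  r. Uniqueness holds because the columns of U are eigenvectors and determine a matrix.\<close>

lemma psd_power_conj_rdiag:
  fixes U :: "complex^'n^'n"
  assumes U: "unitary_matrix U"
  shows "psd_power (conj_rdiag U l) r = conj_rdiag U (\<lambda>i. l i powr r)"
  unfolding psd_power_def
proof (rule the_equality, intro allI impI)
  fix m :: real and x :: "complex^'n"
  assume eig: "conj_rdiag U l *v x = m *\<^sub>R x"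
  define y where "y = cadjoint U *v x"
  have x: "x = U *v y"
    using U by (simp add: y_def matrix_vector_mul_assoc unitaryD)
  have "diagm (\<lambda>i. complex_of_real (l i)) *v y = cadjoint U *v (conj_rdiag U l *v x)"
    using U by (simp add: conj_diag_vector y_def matrix_vector_mul_assoc unitaryD)
  also have "\<dots> = m *\<^sub>R y"
    by (simp add: eig matrix_vector_scaleR y_def)
  finally have "(diagm (\<lambda>i. complex_of_real (l i)) *v y) $ i = (m *\<^sub>R y) $ i" for i
    by (rule arg_cong)
  then have "l i = m \<or> y $ i = 0" for i
    unfolding diagm_vector_component scaleR_vector_component mult_cancel_right of_real_eq_iff
    by blast
  then have "(diagm (\<lambda>i. complex_of_real (l i powr r)) *v y) $ i = ((m powr r) *\<^sub>R y) $ i" for i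
    unfolding diagm_vector_component scaleR_vector_component mult_cancel_right of_real_eq_iff
    by metis
  then have "diagm (\<lambda>i. complex_of_real (l i powr r)) *v y = (m powr r) *\<^sub>R y"
    by (simp add: vec_eq_iff)
  then show "conj_rdiag U (\<lambda>i. l i powr r) *v x = (m powr r) *\<^sub>R x"
    by (simp add: conj_diag_vector y_def[symmetric] matrix_vector_scaleR x[symmetric])
next
  fix C :: "complex^'n^'n"
  assume C: "\<forall>(m::real) v. conj_rdiag U l *v v = m *\<^sub>R v \<longrightarrow> C *v v = (m powr r) *\<^sub>R v"
  have conj_U: "(conj_rdiag U f ** U) $ i $ j = U $ i $ j * f j" for f :: "'n \<Rightarrow> real" and i j
  proof -
    have "conj_rdiag U f ** U = U ** diagm (\<lambda>i. complex_of_real (f i))"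
      using U by (simp add: conj_diag_def matrix_mul_assoc[symmetric] unitaryD)
    then show ?thesis by simp
  qed
  have col: "conj_rdiag U f *v column j U = f j *\<^sub>R column j U" for f j
  proof -
    have "(conj_rdiag U f *v column j U) $ i = (f j *\<^sub>R column j U) $ i" for i
      using conj_U[of f i j] unfolding scaleR_vector_component
      by (simp add: column_def matrix_vector_mult_def matrix_matrix_mult_def mult.commute)
    then show ?thesis by (simp add: vec_eq_iff)
  qed
  have "C *v column j U = conj_rdiag U (\<lambda>i. l i powr r) *v column j U" for j
    using C col by metis
  then have "C ** U = conj_rdiag U (\<lambda>i. l i powr r) ** U"
    by (simp add: vec_eq_iff column_def matrix_vector_mult_def matrix_matrix_mult_def)
  then show "C = conj_rdiag U (\<lambda>i. l i powr r)"
    using U by (metis matrix_mul_assoc matrix_mul_rid unitaryD(2))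
qed

lemma gram_diag:
  fixes B :: "complex^'n^'n"
  shows "(cadjoint B ** B) $ i $ i = of_real (\<Sum>k\<in>UNIV. (cmod (B $ k $ i))\<^sup>2)"
  by (simp add: matrix_matrix_mult_def complex_norm_square mult.commute flip: of_real_power)

text \<open>The numbers s are needed in two roles: as roots of the eigenvalues of
  \<open>cadjoint B ** B\<close>, the form that trace duality uses, and as eigenvalues of |B|, the
  form that Schatten norms use.\<close>

lemma singular_values:
  fixes B :: "complex^'n^'n"
  obtains P s where "unitary_matrix P" "\<And>i. 0 \<le> s i"
    "cadjoint B ** B = conj_rdiag P (\<lambda>i. (s i)\<^sup>2)" "matrix_abs B = conj_rdiag P s"
proof -
  have "hermitian_matrix (cadjoint B ** B)"
    by (simp add: hermitian_matrix_def cadjoint_mult)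
  then obtain P and l :: "'n \<Rightarrow> real"
    where P: "unitary_matrix P" and eq: "cadjoint B ** B = conj_rdiag P l"
    by (rule hermitian_spectral)
  have "cadjoint (B ** P) ** (B ** P) = cadjoint P ** (cadjoint B ** B) ** P"
    by (simp add: cadjoint_mult matrix_mul_assoc)
  also have "\<dots> = diagm (\<lambda>i. complex_of_real (l i))"
    using P by (simp add: eq conj_diag_def matrix_mul_assoc[symmetric] unitaryD)
  finally have "(cadjoint (B ** P) ** (B ** P)) $ i $ i = of_real (l i)" for i
    by (simp add: diagm_def)
  then have "l i = (\<Sum>k\<in>UNIV. (cmod ((B ** P) $ k $ i))\<^sup>2)" for i
    unfolding gram_diag of_real_eq_iff by simp
  then have l: "0 \<le> l i" for i by (simp add: sum_nonneg)
  show thesis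
  proof (rule that[OF P, of "\<lambda>i. sqrt (l i)"])
    show "matrix_abs B = conj_rdiag P (\<lambda>i. sqrt (l i))"
      unfolding matrix_abs_def eq psd_power_conj_rdiag[OF P] using l by (simp add: powr_half_sqrt)
  qed (use l eq in auto)
qed

lemma matrix_abs_conj_rdiag:
  assumes U: "unitary_matrix U"
  shows "matrix_abs (conj_rdiag U l) = conj_rdiag U (\<lambda>i. \<bar>l i\<bar>)"
proof -
  have "cadjoint (conj_rdiag U l) ** conj_rdiag U l = conj_rdiag U (\<lambda>i. (l i)\<^sup>2)"
    by (simp add: cadjoint_conj_diag conj_diag_mult[OF U] power2_eq_square)
  then show ?thesis
    by (simp only: matrix_abs_def psd_power_conj_rdiag[OF U]) (simp add: powr_half_sqrt)
qed

lemma schatten_norm_conj_rdiag: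
  assumes U: "unitary_matrix U"
  shows "schatten_norm q (conj_rdiag U l) = (\<Sum>i\<in>UNIV. \<bar>l i\<bar> powr q) powr (1/q)"
  by (simp add: schatten_norm_def matrix_abs_conj_rdiag[OF U] psd_power_conj_rdiag[OF U]
      trace_conj_diag[OF U])

lemma schatten_norm_nonneg: "0 \<le> schatten_norm q B"
  by (simp add: schatten_norm_def)

lemma trace_mpow_even_eq:
  assumes U: "unitary_matrix U"
  shows "Re (trace (mpow (conj_rdiag U l) (2 * p))) = (\<Sum>i\<in>UNIV. (\<bar>l i\<bar> ^ (2 * p)))"
  by (simp add: mpow_conj_diag[OF U] trace_conj_diag[OF U] power_even_abs flip: of_real_power)

lemma schatten_norm_even_power:
  assumes X: "hermitian_matrix X" and p: "p > 0"
  shows "schatten_norm (2 * real p) X ^ (2 * p) = Re (trace (mpow X (2 * p)))"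
    and "0 \<le> Re (trace (mpow X (2 * p)))"
proof -
  obtain U l where U: "unitary_matrix U" and eq: "X = conj_rdiag U l"
    using X by (rule hermitian_spectral)
  have *: "\<bar>l i\<bar> powr (2 * real p) = \<bar>l i\<bar> ^ (2 * p)" for i
    using p powr_realpow'[of "\<bar>l i\<bar>" "2 * p"] by simp
  have nn: "0 \<le> (\<Sum>i\<in>UNIV. \<bar>l i\<bar> ^ (2 * p))" by (simp add: sum_nonneg)
  have "((\<Sum>i\<in>UNIV. \<bar>l i\<bar> ^ (2 * p)) powr (1 / (2 * real p))) ^ (2 * p)
      = (\<Sum>i\<in>UNIV. \<bar>l i\<bar> ^ (2 * p))"
  proof -
    have "(S powr (1 / (2 * real p))) ^ (2 * p) = S" if "0 \<le> S" for S :: real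
      using p that by (cases "S = 0") (simp_all add: powr_power)
    then show ?thesis using nn by blast
  qed
  then show "schatten_norm (2 * real p) X ^ (2 * p) = Re (trace (mpow X (2 * p)))"
    unfolding eq trace_mpow_even_eq[OF U] schatten_norm_conj_rdiag[OF U] * .
  show "0 \<le> Re (trace (mpow X (2 * p)))"
    unfolding eq trace_mpow_even_eq[OF U] by (rule nn)
qed

section \<open>Trace inequalities\<close>

lemma Young_powr:
  fixes x y :: real
  assumes "0 \<le> x" "0 \<le> y" "0 < a" "0 < b" "a + b = 1"
  shows "x powr a * y powr b \<le> a * x + b * y"
proof (cases "x = 0 \<or> y = 0")
  case True
  then show ?thesis using assms by auto
next
  case False
  then show ?thesis using assms by (intro Youngs_inequality_0) auto
qed

lemma Holder_sum:
  fixes f g w :: "'a \<Rightarrow> real"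
  assumes ab: "0 < a" "0 < b" "a + b = 1" and I: "finite I"
    and w: "\<And>i. i \<in> I \<Longrightarrow> 0 \<le> w i" and f: "\<And>i. i \<in> I \<Longrightarrow> 0 \<le> f i"
    and g: "\<And>i. i \<in> I \<Longrightarrow> 0 \<le> g i"
  shows "(\<Sum>i\<in>I. w i * (f i powr a * g i powr b))
    \<le> (\<Sum>i\<in>I. w i * f i) powr a * (\<Sum>i\<in>I. w i * g i) powr b"
proof -
  define F where "F = (\<Sum>i\<in>I. w i * f i)"
  define G where "G = (\<Sum>i\<in>I. w i * g i)"
  have F0: "0 \<le> F" and G0: "0 \<le> G"
    unfolding F_def G_def by (auto intro!: sum_nonneg simp: w f g)
  consider "F = 0" | "G = 0" | "0 < F" "0 < G" using F0 G0 by linarith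
  then show ?thesis
  proof cases
    case 1
    then have "w i * f i = 0" if "i \<in> I" for i
      using that I w f by (auto simp: F_def sum_nonneg_eq_0_iff)
    then have "w i * (f i powr a * g i powr b) = 0" if "i \<in> I" for i
      using that by fastforce
    then have "(\<Sum>i\<in>I. w i * (f i powr a * g i powr b)) = 0" by (intro sum.neutral) blast
    then show ?thesis by simp
  next
    case 2
    then have "w i * g i = 0" if "i \<in> I" for i
      using that I w g by (auto simp: G_def sum_nonneg_eq_0_iff)
    then have "w i * (f i powr a * g i powr b) = 0" if "i \<in> I" for i
      using that by fastforce
    then have "(\<Sum>i\<in>I. w i * (f i powr a * g i powr b)) = 0" by (intro sum.neutral) blast
    then show ?thesis by simp
  next
    case 3
    have "(\<Sum>i\<in>I. w i * (f i powr a * g i powr b))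
        = (\<Sum>i\<in>I. w i * ((f i / F) powr a * (g i / G) powr b)) * (F powr a * G powr b)"
      unfolding sum_distrib_right using 3 f g
      by (intro sum.cong refl) (simp add: powr_divide)
    also have "\<dots> \<le> 1 * (F powr a * G powr b)"
    proof (rule mult_right_mono)
      have "(\<Sum>i\<in>I. w i * ((f i / F) powr a * (g i / G) powr b))
          \<le> (\<Sum>i\<in>I. w i * (a * (f i / F) + b * (g i / G)))"
        using 3 f g w ab by (intro sum_mono mult_left_mono Young_powr) auto
      also have "\<dots> = (\<Sum>i\<in>I. a / F * (w i * f i)) + (\<Sum>i\<in>I. b / G * (w i * g i))"
        by (simp add: sum.distrib[symmetric] algebra_simps)
      also have "\<dots> = a / F * F + b / G * G"
        by (simp only: F_def G_def sum_distrib_left)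
      also have "\<dots> = 1" using 3 ab by simp
      finally show "(\<Sum>i\<in>I. w i * ((f i / F) powr a * (g i / G) powr b)) \<le> 1" .
    qed simp
    finally show ?thesis by (simp add: F_def G_def)
  qed
qed

section \<open>Traces written in eigenbases\<close>

lemma matrix_mult_component: "(A ** B) $ i $ j = (\<Sum>k\<in>UNIV. A $ i $ k * B $ k $ j)"
  by (simp add: matrix_matrix_mult_def)

text \<open>With M the matrix of H between the two eigenbases, the weights are the numbers |M_kl|^2
  \<ge> 0. This is how inequalities for real numbers apply although the matrices do not
  commute.\<close>

lemma trace_sandwich:
  assumes H: "hermitian_matrix H"
  shows "Re (trace (H ** conj_rdiag P f ** H ** conj_rdiag U g))
    = (\<Sum>(k, l)\<in>UNIV. (cmod ((cadjoint U ** H ** P) $ k $ l))\<^sup>2 * (f l * g k))"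
proof -
  define M where "M = cadjoint U ** H ** P"
  have M': "cadjoint M = cadjoint P ** H ** U"
    using H by (simp add: M_def cadjoint_mult hermitian_matrix_def matrix_mul_assoc)
  have "trace (H ** conj_rdiag P f ** H ** conj_rdiag U g)
      = trace ((H ** P ** diagm f ** cadjoint M ** diagm g) ** cadjoint U)"
    by (simp add: M' conj_diag_def matrix_mul_assoc)
  also have "\<dots> = trace (cadjoint U ** (H ** P ** diagm f ** cadjoint M ** diagm g))"
    by (rule trace_mul_sym)
  also have "\<dots> = trace (M ** diagm f ** cadjoint M ** diagm g)"
    by (simp add: M_def matrix_mul_assoc)
  also have "\<dots> = of_real (\<Sum>k\<in>UNIV. \<Sum>l\<in>UNIV. (cmod (M $ k $ l))\<^sup>2 * (f l * g k))"
  proof -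
    have "(M ** diagm f ** cadjoint M ** diagm g) $ k $ k
        = (\<Sum>l\<in>UNIV. of_real ((cmod (M $ k $ l))\<^sup>2 * (f l * g k)))" for k
    proof -
      have "(M ** diagm f ** cadjoint M ** diagm g) $ k $ k
        = (\<Sum>l\<in>UNIV. (M ** diagm f) $ k $ l * cadjoint M $ l $ k) * g k"
        unfolding mult_diagm_component matrix_mult_component[of "M ** diagm f"] ..
      also have "\<dots> = (\<Sum>l\<in>UNIV. (M $ k $ l * cnj (M $ k $ l)) * (f l * g k))"
        by (subst sum_distrib_right) (simp add: mult_ac)
      finally show ?thesis unfolding complex_norm_square[symmetric] by simp
    qed
    then show ?thesis by (simp add: trace_def)
  qed
  finally show ?thesis by (simp add: M_def sum.cartesian_product UNIV_Times_UNIV)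
qed

lemma hermitian_mat1: "hermitian_matrix (mat 1)"
  by (simp add: hermitian_matrix_def)

lemma Re_trace_conj_rdiag: "unitary_matrix U \<Longrightarrow> Re (trace (conj_rdiag U f)) = sum f UNIV"
  by (simp add: trace_conj_diag)

text \<open>Both traces on the right come from the same non-negative weights, so this is the ordinary
  Hoelder inequality.\<close>
lemma trace_Holder:
  assumes H: "\<And>i. i \<in> I \<Longrightarrow> hermitian_matrix (H i)" and I: "finite I"
    and P: "unitary_matrix P" and U: "unitary_matrix U"
    and ab: "0 < a" "0 < b" "a + b = 1"
    and f: "\<And>k. 0 \<le> f k" and g: "\<And>k. 0 \<le> g k"
  shows "(\<Sum>i\<in>I. Re (trace (H i ** conj_rdiag P (\<lambda>k. f k powr a) ** H i ** conj_rdiag U (\<lambda>k. g k powr b))))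
    \<le> (\<Sum>i\<in>I. Re (trace (H i ** H i ** conj_rdiag P f))) powr a
      * (\<Sum>i\<in>I. Re (trace (H i ** H i ** conj_rdiag U g))) powr b"
proof -
  define w where "w = (\<lambda>(k, l). \<Sum>i\<in>I. (cmod ((cadjoint U ** H i ** P) $ k $ l))\<^sup>2)"
  have sandwich: "(\<Sum>i\<in>I. Re (trace (H i ** conj_rdiag P f ** H i ** conj_rdiag U g)))
      = (\<Sum>x\<in>UNIV. w x * (f (snd x) * g (fst x)))" for f g :: "_ \<Rightarrow> real"
  proof -
    have "(\<Sum>i\<in>I. Re (trace (H i ** conj_rdiag P f ** H i ** conj_rdiag U g)))
      = (\<Sum>i\<in>I. \<Sum>(k, l)\<in>UNIV. (cmod ((cadjoint U ** H i ** P) $ k $ l))\<^sup>2 * (f l * g k))"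
      by (intro sum.cong refl trace_sandwich H)
    also have "\<dots> = (\<Sum>x\<in>UNIV. w x * (f (snd x) * g (fst x)))"
      by (subst sum.swap) (simp add: w_def case_prod_unfold sum_distrib_right)
    finally show ?thesis .
  qed
  \<comment> \<open>A constant function 1 in one slot gives the identity matrix, so the traces on
    the right-hand side are sums with the same weights.\<close>
  have F: "(\<Sum>i\<in>I. Re (trace (H i ** H i ** conj_rdiag P f))) = (\<Sum>x\<in>UNIV. w x * f (snd x))"
  proof -
    have "trace (H i ** H i ** conj_rdiag P f)
        = trace (H i ** conj_rdiag P f ** H i ** conj_rdiag U (\<lambda>_. 1))" for i
      by (simp add: conj_diag_one[OF U] trace_rot[of "H i" "H i"] trace_rot[of "H i" _ "H i"])
    then show ?thesis using sandwich[of f "\<lambda>_. 1"] by simp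
  qed
  have G: "(\<Sum>i\<in>I. Re (trace (H i ** H i ** conj_rdiag U g))) = (\<Sum>x\<in>UNIV. w x * g (fst x))"
  proof -
    have "H i ** H i ** conj_rdiag U g = H i ** conj_rdiag P (\<lambda>_. 1) ** H i ** conj_rdiag U g" for i
      by (simp add: conj_diag_one[OF P])
    then show ?thesis using sandwich[of "\<lambda>_. 1" g] by simp
  qed
  show ?thesis unfolding sandwich F G
    by (rule Holder_sum[OF ab]) (auto simp: f g w_def case_prod_unfold intro!: sum_nonneg)
qed

text \<open>Chebyshev's argument: a^m - b^m and a^n - b^n have the same sign.\<close>

lemma power_exchange_le:
  fixes a b :: real
  assumes "0 \<le> a" "0 \<le> b"
  shows "a ^ m * b ^ n + b ^ m * a ^ n \<le> a ^ (m + n) + b ^ (m + n)"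
proof -
  have "0 \<le> (a ^ m - b ^ m) * (a ^ n - b ^ n)"
  proof (cases "a \<le> b")
    case True
    then show ?thesis using assms by (intro mult_nonpos_nonpos) (auto intro: power_mono)
  next
    case False
    then show ?thesis using assms by (intro mult_nonneg_nonneg) (auto intro: power_mono)
  qed
  then show ?thesis by (simp add: algebra_simps power_add)
qed

text \<open>Once x^2 y^2 is taken out, \<open>power_exchange_le\<close> applies to the remaining
  exponents, whose even sum lets the absolute values be dropped. A single monomial with r > 2 is not
  dominated when x is much larger than y, hence the symmetrised form.\<close>

lemma symmetrized_monomial_le:
  fixes x y :: real
  assumes "2 \<le> r" "r + 2 \<le> N" "even N"
  shows "x ^ r * y ^ (N - r) + y ^ r * x ^ (N - r) \<le> x\<^sup>2 * y ^ (N - 2) + y\<^sup>2 * x ^ (N - 2)"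
proof -
  define m where "m = r - 2"
  define n where "n = N - r - 2"
  have r: "r = m + 2" and N: "N = m + n + 4" using assms by (auto simp: m_def n_def)
  have "even (m + n)" using \<open>even N\<close> N by simp
  have "x ^ m * y ^ n + y ^ m * x ^ n \<le> \<bar>x\<bar> ^ m * \<bar>y\<bar> ^ n + \<bar>y\<bar> ^ m * \<bar>x\<bar> ^ n"
    by (intro add_mono) (metis abs_ge_self abs_mult power_abs)+
  also have "\<dots> \<le> \<bar>x\<bar> ^ (m + n) + \<bar>y\<bar> ^ (m + n)"
    by (rule power_exchange_le) auto
  also have "\<dots> = x ^ (m + n) + y ^ (m + n)"
    using \<open>even (m + n)\<close> by (simp add: power_even_abs)
  finally have "x\<^sup>2 * y\<^sup>2 * (x ^ m * y ^ n + y ^ m * x ^ n) \<le> x\<^sup>2 * y\<^sup>2 * (x ^ (m + n) + y ^ (m + n))"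
    by (rule mult_left_mono) simp
  moreover have "N - r = n + 2" "N - 2 = m + n + 2" using r N by auto
  ultimately show ?thesis by (simp add: r power_add power2_eq_square algebra_simps)
qed

text \<open>This is y^(N-2) (x - y)^2 \<ge> 0. The exponent 1 is too small for x^2 y^2 to be taken
  out, so part of the bound has to be the pure power y^N.\<close>

lemma monomial_one_le:
  fixes x y :: real
  assumes "2 \<le> N" "even N"
  shows "2 * (x * y ^ (N - 1)) \<le> y ^ N + x\<^sup>2 * y ^ (N - 2)"
proof -
  obtain m where N: "N = m + 2" using assms(1) by (metis le_add_diff_inverse2)
  have "even m" using assms N by simp
  then have "0 \<le> y ^ m * (x - y)\<^sup>2" by (simp add: zero_le_even_power)
  then show ?thesis by (simp add: N power2_eq_square algebra_simps)
qed

text \<open>The two extreme terms equal \<open>T 0\<close>, the next two are at most \<open>(T 0 + T 2) / 2\<close>, and the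
  remaining \<open>2p - 5\<close> are at most \<open>T 2\<close>.\<close>
lemma sum_monomials_le:
  fixes c :: "'n::finite \<Rightarrow> 'n \<Rightarrow> real" and x :: "'n \<Rightarrow> real" and p :: nat
  assumes p: "3 \<le> p" and c: "\<And>k l. 0 \<le> c k l" "\<And>k l. c k l = c l k"
  defines "T \<equiv> \<lambda>r. \<Sum>k\<in>UNIV. \<Sum>l\<in>UNIV. c k l * (x l ^ r * x k ^ (2 * p - 2 - r))"
  shows "(\<Sum>r\<le>2 * p - 2. T r) \<le> 3 * T 0 + (2 * real p - 4) * T 2"
proof -
  define N where "N = 2 * p - 2"
  have N: "4 \<le> N" "even N" using p by (auto simp: N_def)
  have T: "T r = (\<Sum>k\<in>UNIV. \<Sum>l\<in>UNIV. c k l * (x l ^ r * x k ^ (N - r)))" for r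
    by (simp add: T_def N_def)
  have swap: "T r = (\<Sum>k\<in>UNIV. \<Sum>l\<in>UNIV. c k l * (x k ^ r * x l ^ (N - r)))" for r
    unfolding T by (subst sum.swap) (intro sum.cong refl, simp add: c(2))
  have T_sym: "T (N - r) = T r" if "r \<le> N" for r
    unfolding swap[of r] using that by (simp add: T mult_ac)
  have T_mid: "T r \<le> T 2" if "2 \<le> r" "r + 2 \<le> N" for r
  proof -
    \<comment> \<open>Averaging over the exchange of k and l, under which c is invariant, produces
      the symmetrised monomials.\<close>
    have "2 * T r = (\<Sum>k\<in>UNIV. \<Sum>l\<in>UNIV. c k l * (x l ^ r * x k ^ (N - r) + x k ^ r * x l ^ (N - r)))"
      unfolding mult_2 by (subst (2) swap, simp only: T sum.distrib[symmetric] distrib_left)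
    also have "\<dots> \<le> (\<Sum>k\<in>UNIV. \<Sum>l\<in>UNIV. c k l * (x l ^ 2 * x k ^ (N - 2) + x k ^ 2 * x l ^ (N - 2)))"
      by (intro sum_mono mult_left_mono symmetrized_monomial_le that N c)
    also have "\<dots> = 2 * T 2"
      unfolding mult_2[of "T 2"] by (subst (2) swap, simp only: T sum.distrib[symmetric] distrib_left)
    finally show ?thesis by simp
  qed
  have T_one: "2 * T 1 \<le> T 0 + T 2"
  proof -
    have "2 * T 1 = (\<Sum>k\<in>UNIV. \<Sum>l\<in>UNIV. c k l * (2 * (x l * x k ^ (N - 1))))"
      by (simp add: T sum_distrib_left mult_ac)
    also have "\<dots> \<le> (\<Sum>k\<in>UNIV. \<Sum>l\<in>UNIV. c k l * (x k ^ N + (x l)\<^sup>2 * x k ^ (N - 2)))"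
      using N by (intro sum_mono mult_left_mono monomial_one_le c) auto
    also have "\<dots> = T 0 + T 2" by (simp add: T sum.distrib distrib_left)
    finally show ?thesis .
  qed
  \<comment> \<open>N \<ge> 4 makes the four extreme exponents distinct and leaves N - 3 = 2p - 5
    exponents in the middle.\<close>
  have split: "{..N} = {0, 1, N - 1, N} \<union> {2..N - 2}" using N by auto
  have "(\<Sum>r\<le>N. T r) = T 0 + T 1 + T (N - 1) + T N + (\<Sum>r\<in>{2..N - 2}. T r)"
    unfolding split using N by (subst sum.union_disjoint) auto
  also have "\<dots> = 2 * T 0 + 2 * T 1 + (\<Sum>r\<in>{2..N - 2}. T r)"
    using T_sym[of 0] T_sym[of 1] N by simp
  also have "(\<Sum>r\<in>{2..N - 2}. T r) \<le> of_nat (card {2..N - 2}) * T 2"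
    using N by (intro sum_bounded_above T_mid) auto
  also have "of_nat (card {2..N - 2}) = 2 * real p - 5"
    using p by (simp add: N_def of_nat_diff)
  finally have "(\<Sum>r\<le>N. T r) \<le> 2 * T 0 + 2 * T 1 + (2 * real p - 5) * T 2" by simp
  also have "\<dots> \<le> 3 * T 0 + (2 * real p - 4) * T 2"
    using T_one by (simp add: algebra_simps)
  finally show ?thesis by (simp add: N_def)
qed

section \<open>The parameter w and Hoelder duality\<close>

text \<open>If \<open>W\<^sup>*W\<close> is a coordinate projection fixing \<open>W\<close>, then \<open>WW\<^sup>*\<close> is a projection as well.\<close>
lemma partial_isometry_row_le_1:
  fixes W :: "complex^'n^'n"
  assumes "W ** (cadjoint W ** W) = W"
  shows "(\<Sum>k\<in>UNIV. (cmod (W $ l $ k))\<^sup>2) \<le> 1"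
proof -
  define E where "E = W ** cadjoint W"
  define e where "e = (\<Sum>k\<in>UNIV. (cmod (W $ l $ k))\<^sup>2)"
  have "cadjoint E ** E = W ** (cadjoint W ** W) ** cadjoint W"
    by (simp add: E_def cadjoint_mult matrix_mul_assoc)
  then have E: "cadjoint E ** E = E" by (simp add: assms E_def)
  have El: "E $ l $ l = of_real e"
    using gram_diag[of "cadjoint W" l] by (simp add: E_def e_def)
  \<comment> \<open>A diagonal entry of a projection equals the squared norm of its column, and that
    column contains the entry itself; so e^2 \<le> e.\<close>
  have "of_real e = complex_of_real (\<Sum>k\<in>UNIV. (cmod (E $ k $ l))\<^sup>2)"
    using gram_diag[of E l] by (simp only: E El)
  then have "e = (\<Sum>k\<in>UNIV. (cmod (E $ k $ l))\<^sup>2)" by (simp only: of_real_eq_iff)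
  also have "\<dots> \<ge> (cmod (E $ l $ l))\<^sup>2"
    by (rule member_le_sum) auto
  finally have "e\<^sup>2 \<le> e" by (simp add: El)
  moreover have "0 \<le> e" by (simp add: e_def sum_nonneg)
  ultimately have "e \<le> 1"
    using mult_strict_right_mono[of 1 e e] unfolding power2_eq_square by linarith
  then show ?thesis by (simp only: e_def)
qed

lemma unitary_column_sum:
  assumes "unitary_matrix U"
  shows "(\<Sum>k\<in>UNIV. (cmod (U $ k $ l))\<^sup>2) = 1"
proof -
  have "of_real (\<Sum>k\<in>UNIV. (cmod (U $ k $ l))\<^sup>2) = (1 :: complex)"
    unfolding gram_diag[symmetric] unitaryD(1)[OF assms] by (simp add: mat_def)
  then show ?thesis by (metis of_real_eq_1_iff)
qed

lemma unitary_row_sum: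
  assumes "unitary_matrix U"
  shows "(\<Sum>k\<in>UNIV. (cmod (U $ l $ k))\<^sup>2) = 1"
  using unitary_column_sum[OF unitary_cadjoint[OF assms], of l] by simp

text \<open>Splitting a product of entries of a partial isometry and of a unitary by AM-GM leaves a
  doubly substochastic array of weights.\<close>
lemma trace_duality:
  fixes B P Q Q' :: "complex^'n^'n" and s d :: "'n \<Rightarrow> real"
  assumes P: "unitary_matrix P" and BB: "cadjoint B ** B = conj_rdiag P (\<lambda>k. (s k)\<^sup>2)"
    and s: "\<And>k. 0 \<le> s k" and d: "\<And>k. 0 \<le> d k"
    and Q: "unitary_matrix Q" and Q': "unitary_matrix Q'"
    and ab: "0 < a" "0 < b" "a + b = 1"
  shows "cmod (trace (B ** (Q ** diagm (\<lambda>k. of_real (d k)) ** Q')))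
    \<le> (\<Sum>k\<in>UNIV. s k powr (1 / a)) powr a * (\<Sum>k\<in>UNIV. d k powr (1 / b)) powr b"
proof -
  \<comment> \<open>By cyclicity the trace becomes that of C, R and the diagonal matrix in this
    order, where R is unitary and the columns of C are orthogonal with lengths s.\<close>
  define C where "C = Q' ** B ** P"
  define R where "R = cadjoint P ** Q"
  \<comment> \<open>The partial isometry in the polar decomposition of C. Since inverse 0 = 0, its
    columns vanish where s does.\<close>
  define W where "W = C ** diagm (\<lambda>k. of_real (inverse (s k)))"
  have R: "unitary_matrix R" unfolding R_def by (intro unitary_mult unitary_cadjoint P Q)
  have "cadjoint C ** C = cadjoint P ** (cadjoint B ** B) ** P"
    unfolding C_def cadjoint_mult matrix_mul_assoc[symmetric] unitaryD(3)[OF Q'] ..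
  also have "\<dots> = diagm (\<lambda>k. of_real ((s k)\<^sup>2))"
    using P by (simp add: BB conj_diag_def matrix_mul_assoc[symmetric] unitaryD)
  finally have CC: "cadjoint C ** C = diagm (\<lambda>k. of_real ((s k)\<^sup>2))" .
  have Ccol: "(\<Sum>l\<in>UNIV. (cmod (C $ l $ k))\<^sup>2) = (s k)\<^sup>2" for k
  proof -
    have "complex_of_real (\<Sum>l\<in>UNIV. (cmod (C $ l $ k))\<^sup>2) = of_real ((s k)\<^sup>2)"
      unfolding gram_diag[symmetric] CC by (simp add: diagm_def)
    then show ?thesis by (simp only: of_real_eq_iff)
  qed
  have C0: "C $ l $ k = 0" if "s k = 0" for l k
    using Ccol[of k] that by (simp add: sum_nonneg_eq_0_iff)
  have CW: "C $ l $ k = W $ l $ k * of_real (s k)" for l k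
    using C0[of k l] by (cases "s k = 0") (simp_all add: W_def)
  define \<pi> where "\<pi> = (\<lambda>k. if s k = 0 then 0 else 1 :: complex)"
  have "cadjoint W ** W = diagm (\<lambda>k. of_real (inverse (s k))) ** (cadjoint C ** C)
      ** diagm (\<lambda>k. of_real (inverse (s k)))"
    by (simp add: W_def cadjoint_mult cadjoint_diagm matrix_mul_assoc)
  also have "\<dots> = diagm \<pi>"
    unfolding CC diagm_mult by (intro arg_cong[of _ _ diagm] ext) (simp add: \<pi>_def power2_eq_square field_simps)
  finally have WW: "cadjoint W ** W = diagm \<pi>" .
  have "W ** diagm \<pi> = W"
    by (simp add: vec_eq_iff W_def \<pi>_def)
  then have Wrow: "(\<Sum>k\<in>UNIV. (cmod (W $ l $ k))\<^sup>2) \<le> 1" for l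
    by (intro partial_isometry_row_le_1) (simp add: WW)
  have Wcol: "(\<Sum>l\<in>UNIV. (cmod (W $ l $ k))\<^sup>2) \<le> 1" for k
  proof -
    have "complex_of_real (\<Sum>l\<in>UNIV. (cmod (W $ l $ k))\<^sup>2) = of_real (if s k = 0 then 0 else 1)"
      unfolding gram_diag[symmetric] WW by (simp add: diagm_def \<pi>_def)
    then show ?thesis unfolding of_real_eq_iff by simp
  qed
  define c where "c = (\<lambda>l k. ((cmod (W $ l $ k))\<^sup>2 + (cmod (R $ k $ l))\<^sup>2) / 2)"
  have c0: "0 \<le> c l k" for l k by (simp add: c_def)
  have crow: "(\<Sum>k\<in>UNIV. c l k) \<le> 1" for l
    using Wrow[of l] unitary_column_sum[OF R, of l]
    by (simp add: c_def sum_divide_distrib[symmetric] sum.distrib)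
  have ccol: "(\<Sum>l\<in>UNIV. c l k) \<le> 1" for k
    using Wcol[of k] unitary_row_sum[OF R, of k]
    by (simp add: c_def sum_divide_distrib[symmetric] sum.distrib)
  have "trace (B ** (Q ** diagm (\<lambda>k. of_real (d k)) ** Q'))
      = trace (B ** Q ** diagm (\<lambda>k. of_real (d k)) ** Q')"
    by (simp add: matrix_mul_assoc)
  also have "\<dots> = trace (Q' ** (B ** Q ** diagm (\<lambda>k. of_real (d k))))"
    by (rule trace_mul_sym)
  also have "Q' ** (B ** Q ** diagm (\<lambda>k. of_real (d k))) = (C ** R) ** diagm (\<lambda>k. of_real (d k))"
    unfolding C_def R_def matrix_mul_assoc[symmetric] unitaryD(4)[OF P] ..
  finally have "cmod (trace (B ** (Q ** diagm (\<lambda>k. of_real (d k)) ** Q')))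
      = cmod (\<Sum>l\<in>UNIV. \<Sum>k\<in>UNIV. C $ l $ k * R $ k $ l * of_real (d l))"
    by (simp add: trace_def matrix_mult_component[of C] sum_distrib_right)
  also have "\<dots> \<le> (\<Sum>l\<in>UNIV. \<Sum>k\<in>UNIV. cmod (C $ l $ k * R $ k $ l * of_real (d l)))"
    by (intro order_trans[OF norm_sum] sum_mono norm_sum)
  also have "\<dots> \<le> (\<Sum>l\<in>UNIV. \<Sum>k\<in>UNIV. c l k * (s k * d l))"
  proof (intro sum_mono)
    fix l k
    have "cmod (W $ l $ k) * cmod (R $ k $ l) \<le> c l k"
      using sum_squares_bound[of "cmod (W $ l $ k)" "cmod (R $ k $ l)"] by (simp add: c_def)
    then have "(cmod (W $ l $ k) * cmod (R $ k $ l)) * (s k * d l) \<le> c l k * (s k * d l)"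
      by (intro mult_right_mono mult_nonneg_nonneg s d)
    then show "cmod (C $ l $ k * R $ k $ l * of_real (d l)) \<le> c l k * (s k * d l)"
      using s d by (simp add: CW norm_mult mult_ac)
  qed
  also have "\<dots> = (\<Sum>(l, k)\<in>UNIV. c l k * ((s k powr (1 / a)) powr a * (d l powr (1 / b)) powr b))"
    using ab s d by (simp add: sum.cartesian_product powr_powr)
  also have "\<dots> \<le> (\<Sum>(l, k)\<in>UNIV. c l k * s k powr (1 / a)) powr a
      * (\<Sum>(l, k)\<in>UNIV. c l k * d l powr (1 / b)) powr b"
    using Holder_sum[OF ab, of UNIV "\<lambda>(l, k). c l k" "\<lambda>(l, k). s k powr (1 / a)" "\<lambda>(l, k). d l powr (1 / b)"] c0
    by (simp add: case_prod_unfold)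
  \<comment> \<open>Column sums of c at most 1 remove the weights from the first factor, row sums at
    most 1 from the second.\<close>
  also have "\<dots> \<le> (\<Sum>k\<in>UNIV. s k powr (1 / a)) powr a * (\<Sum>k\<in>UNIV. d k powr (1 / b)) powr b"
  proof (intro mult_mono powr_mono2)
    have "(\<Sum>(l, k)\<in>UNIV. c l k * s k powr (1 / a)) = (\<Sum>k\<in>UNIV. (\<Sum>l\<in>UNIV. c l k) * s k powr (1 / a))"
      unfolding sum_distrib_right
      by (subst sum.swap) (simp add: sum.cartesian_product)
    also have "\<dots> \<le> (\<Sum>k\<in>UNIV. 1 * s k powr (1 / a))"
      by (intro sum_mono mult_right_mono ccol) auto
    finally show "(\<Sum>(l, k)\<in>UNIV. c l k * s k powr (1 / a)) \<le> (\<Sum>k\<in>UNIV. s k powr (1 / a))" by simp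
    have "(\<Sum>(l, k)\<in>UNIV. c l k * d l powr (1 / b)) = (\<Sum>l\<in>UNIV. (\<Sum>k\<in>UNIV. c l k) * d l powr (1 / b))"
      unfolding sum_distrib_right by (simp add: sum.cartesian_product)
    also have "\<dots> \<le> (\<Sum>l\<in>UNIV. 1 * d l powr (1 / b))"
      by (intro sum_mono mult_right_mono crow) auto
    finally show "(\<Sum>(l, k)\<in>UNIV. c l k * d l powr (1 / b)) \<le> (\<Sum>k\<in>UNIV. d k powr (1 / b))" by simp
  qed (use ab c0 in \<open>auto intro!: sum_nonneg mult_nonneg_nonneg\<close>)
  finally show ?thesis .
qed

section \<open>Frobenius norm bounds for the supremum defining w\<close>

lemma norm_matrix_square: "(norm (A :: complex^'n^'m))\<^sup>2 = (\<Sum>i\<in>UNIV. \<Sum>j\<in>UNIV. (cmod (A $ i $ j))\<^sup>2)"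
  by (simp add: norm_vec_def L2_set_def sum_nonneg)

lemma singular_value_le_norm:
  fixes B P :: "complex^'n^'n"
  assumes P: "unitary_matrix P" and BB: "cadjoint B ** B = conj_rdiag P (\<lambda>k. (s k)\<^sup>2)"
  shows "s k \<le> norm B"
proof -
  have "(s k)\<^sup>2 \<le> (\<Sum>k\<in>UNIV. (s k)\<^sup>2)" by (rule member_le_sum) auto
  also have "\<dots> = Re (trace (cadjoint B ** B))"
    unfolding BB Re_trace_conj_rdiag[OF P] ..
  also have "\<dots> = (\<Sum>j\<in>UNIV. \<Sum>i\<in>UNIV. (cmod (B $ i $ j))\<^sup>2)"
    unfolding trace_def gram_diag by simp
  also have "\<dots> = (norm B)\<^sup>2"
    unfolding norm_matrix_square by (rule sum.swap)
  finally show ?thesis by (rule power2_le_imp_le) simp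
qed

lemma schatten_norm_quarter:
  assumes P: "unitary_matrix P" and B: "matrix_abs B = conj_rdiag P s" and s: "\<And>k. 0 \<le> s k"
  shows "schatten_norm (2 * q) (psd_power (matrix_abs B) (1/4))
    = (\<Sum>k\<in>UNIV. s k powr (q / 2)) powr (1 / (2 * q))"
  unfolding B psd_power_conj_rdiag[OF P] schatten_norm_conj_rdiag[OF P]
  by (simp add: powr_powr)

text \<open>A crude bound by the Frobenius norm; its purpose is to show that the supremum in
  \<open>matrix_w\<close> is taken over a bounded set.\<close>

lemma schatten_norm_quarter_le:
  fixes B :: "complex^'n^'n"
  assumes q: "0 < q"
  shows "schatten_norm (2 * q) (psd_power (matrix_abs B) (1/4))
    \<le> (real CARD('n) * norm B powr (q / 2)) powr (1 / (2 * q))"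
proof -
  obtain P s where Ps: "unitary_matrix P" "\<And>k. 0 \<le> s k"
    "cadjoint B ** B = conj_rdiag P (\<lambda>k. (s k)\<^sup>2)" "matrix_abs B = conj_rdiag P s"
    using singular_values[of B] by blast
  have "(\<Sum>k\<in>UNIV. s k powr (q / 2)) \<le> (\<Sum>k\<in>(UNIV :: 'n set). norm B powr (q / 2))"
    using q by (intro sum_mono powr_mono2 Ps singular_value_le_norm[OF Ps(1,3)]) auto
  then show ?thesis
    unfolding schatten_norm_quarter[OF Ps(1,4,2)] using q by (intro powr_mono2 sum_nonneg) auto
qed

lemma norm_unitary:
  fixes U :: "complex^'n^'n"
  assumes "unitary_matrix U"
  shows "norm U = sqrt (real CARD('n))"
  by (rule real_sqrt_unique[symmetric]) (simp_all add: norm_matrix_square unitary_row_sum[OF assms])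

lemma bounded_image_matrix_mult:
  fixes f g :: "'x \<Rightarrow> complex^'n^'n"
  assumes "bounded (f ` S)" "bounded (g ` S)"
  shows "bounded ((\<lambda>x. f x ** g x) ` S)"
proof -
  obtain K where K: "0 \<le> K" "\<And>(A :: complex^'n^'n) (B :: complex^'n^'n). norm (A ** B) \<le> norm A * norm B * K"
    using mmult.nonneg_bounded by blast
  obtain a b where ab: "\<And>x. x \<in> S \<Longrightarrow> norm (f x) \<le> a" "\<And>x. x \<in> S \<Longrightarrow> norm (g x) \<le> b"
    using assms unfolding bounded_iff by auto
  have "norm (f x ** g x) \<le> \<bar>a\<bar> * \<bar>b\<bar> * K" if "x \<in> S" for x
  proof -
    have "norm (f x) \<le> \<bar>a\<bar>" "norm (g x) \<le> \<bar>b\<bar>" using ab[OF that] by linarith+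
    then have "norm (f x) * norm (g x) * K \<le> \<bar>a\<bar> * \<bar>b\<bar> * K"
      using K(1) by (intro mult_right_mono mult_mono) auto
    with K(2)[of "f x" "g x"] show ?thesis by (rule order_trans)
  qed
  then show ?thesis unfolding bounded_iff by blast
qed

lemma bounded_image_sum:
  fixes f :: "'i \<Rightarrow> 'x \<Rightarrow> 'a::real_normed_vector"
  assumes "\<And>i. i \<in> I \<Longrightarrow> bounded (f i ` S)"
  shows "bounded ((\<lambda>x. \<Sum>i\<in>I. f i x) ` S)"
proof -
  have zero: "bounded ((\<lambda>x. 0 :: 'a) ` S)" by (rule bounded_subset[of "{0}"]) auto
  show ?thesis
    using assms by (induction I rule: infinite_finite_induct) (auto simp: zero intro: bounded_plus_comp)
qed

section \<open>Crossing sums and their traces\<close>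

definition crossing :: "nat \<Rightarrow> (nat \<Rightarrow> complex^'d^'d) \<Rightarrow> complex^'d^'d \<Rightarrow> complex^'d^'d \<Rightarrow> complex^'d^'d \<Rightarrow> complex^'d^'d" where
  "crossing n H Q1 Q2 Q3 =
    (\<Sum>i\<in>{1..n}. \<Sum>j\<in>{1..n}. H i ** Q1 ** H j ** Q2 ** H i ** Q3 ** H j)"

text \<open>A real supremum dominates its members once they are bounded above. Unitary matrices all
  have Frobenius norm sqrt CARD('d), so the crossing sums are bounded, and with them the norms under
  the supremum.\<close>

lemma schatten_crossing_le_matrix_w:
  fixes H :: "nat \<Rightarrow> complex^'d^'d"
  assumes q: "0 < q" and Q: "unitary_matrix Q1" "unitary_matrix Q2" "unitary_matrix Q3"
  shows "schatten_norm (2 * q) (psd_power (matrix_abs (crossing n H Q1 Q2 Q3)) (1/4))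
    \<le> matrix_w (2 * q) n H"
proof -
  let ?U = "Collect (unitary_matrix :: complex^'d^'d \<Rightarrow> bool)"
  let ?S = "?U \<times> ?U \<times> ?U"
  have unit: "bounded ?U"
    unfolding bounded_iff by (auto simp: norm_unitary)
  have proj: "bounded (fst ` ?S)" "bounded ((\<lambda>x. fst (snd x)) ` ?S)" "bounded ((\<lambda>x. snd (snd x)) ` ?S)"
    unfolding bounded_iff by (auto simp: norm_unitary)
  have const: "bounded ((\<lambda>x. A) ` ?S)" for A :: "complex^'d^'d"
    by (rule bounded_subset[of "{A}"]) auto
  have "bounded ((\<lambda>x. crossing n H (fst x) (fst (snd x)) (snd (snd x))) ` ?S)"
    unfolding crossing_def
    by (intro bounded_image_sum bounded_image_matrix_mult proj const)
  then obtain b where b: "\<And>x. x \<in> ?S \<Longrightarrow> norm (crossing n H (fst x) (fst (snd x)) (snd (snd x))) \<le> b"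
    unfolding bounded_iff by blast
  let ?g = "\<lambda>x. schatten_norm (2 * q) (psd_power (matrix_abs
    (crossing n H (fst x) (fst (snd x)) (snd (snd x)))) (1/4))"
  have "bdd_above (?g ` ?S)"
  proof (rule bdd_aboveI2)
    fix x assume "x \<in> ?S"
    then show "?g x \<le> (real CARD('d) * b powr (q / 2)) powr (1 / (2 * q))"
      using q by (intro order_trans[OF schatten_norm_quarter_le] powr_mono2 mult_left_mono b) auto
  qed
  then have "?g (Q1, Q2, Q3) \<le> (SUP x\<in>?S. ?g x)"
    by (rule cSUP_upper2[where x = "(Q1, Q2, Q3)"]) (use Q in auto)
  then show ?thesis by (simp add: matrix_w_def crossing_def case_prod_unfold)
qed

lemma matrix_w_nonneg: "0 < q \<Longrightarrow> 0 \<le> matrix_w (2 * q) n (H :: nat \<Rightarrow> complex^'d^'d)"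
  by (rule order_trans[OF schatten_norm_nonneg schatten_crossing_le_matrix_w])
    (rule unitary_mat1 | assumption)+

text \<open>The arguments fill the four slots between the letters H_i, H_j, H_i, H_j, read
  cyclically. When three of them are unitary, they are the matrices of w and the fourth is the one
  paired by duality.\<close>

definition cross_trace :: "nat \<Rightarrow> (nat \<Rightarrow> complex^'d^'d) \<Rightarrow> complex^'d^'d \<Rightarrow> complex^'d^'d \<Rightarrow> complex^'d^'d \<Rightarrow> complex^'d^'d \<Rightarrow> complex" where
  "cross_trace n H Y1 Y2 Y3 Y4 =
    (\<Sum>i\<in>{1..n}. \<Sum>j\<in>{1..n}. trace (H i ** Y1 ** H j ** Y2 ** H i ** Y3 ** H j ** Y4))"

text \<open>Cyclicity moves the first letter to the end and renaming i and j restores the pattern.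
  Hence a power of X in any slot can be brought to the last one.\<close>

lemma cross_trace_rotate: "cross_trace n H Y1 Y2 Y3 Y4 = cross_trace n H Y2 Y3 Y4 Y1"
proof -
  have "trace (H i ** Y1 ** H j ** Y2 ** H i ** Y3 ** H j ** Y4)
      = trace (H j ** Y2 ** H i ** Y3 ** H j ** Y4 ** H i ** Y1)" for i j
    using trace_mul_sym[of "H i ** Y1" "H j ** Y2 ** H i ** Y3 ** H j ** Y4"]
    by (simp add: matrix_mul_assoc)
  then show ?thesis unfolding cross_trace_def by (subst sum.swap) simp
qed

lemma cross_trace_eq: "cross_trace n H Q1 Q2 Q3 Y = trace (crossing n H Q1 Q2 Q3 ** Y)"
  by (simp add: cross_trace_def crossing_def mmult.sum_left trace_sum)

text \<open>The fourth power undoes the fourth root in w: the fourth power of the 2q-norm of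
  |B|^(1/4) is the q/2-norm of B, and q / (q - 2) is the exponent conjugate to q / 2.\<close>

lemma cross_trace_one_diagonal:
  fixes H :: "nat \<Rightarrow> complex^'d^'d"
  assumes q: "2 < q" and Q: "unitary_matrix Q1" "unitary_matrix Q2" "unitary_matrix Q3"
    "unitary_matrix Q" "unitary_matrix Q'" and d: "\<And>k. 0 \<le> d k"
  shows "cmod (cross_trace n H Q1 Q2 Q3 (Q ** diagm (\<lambda>k. of_real (d k)) ** Q'))
    \<le> matrix_w (2 * q) n H ^ 4 * (\<Sum>k\<in>UNIV. d k powr (q / (q - 2))) powr ((q - 2) / q)"
proof -
  let ?B = "crossing n H Q1 Q2 Q3"
  obtain P s where Ps: "unitary_matrix P" "\<And>k. 0 \<le> s k"
    "cadjoint ?B ** ?B = conj_rdiag P (\<lambda>k. (s k)\<^sup>2)" "matrix_abs ?B = conj_rdiag P s"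
    using singular_values[of ?B] by blast
  define S where "S = (\<Sum>k\<in>UNIV. s k powr (q / 2))"
  have S: "0 \<le> S" by (simp add: S_def sum_nonneg)
  have "S powr (1 / (2 * q)) \<le> matrix_w (2 * q) n H"
    using schatten_crossing_le_matrix_w[of q Q1 Q2 Q3 n H] q Q
    by (simp add: schatten_norm_quarter[OF Ps(1,4,2)] S_def)
  then have "(S powr (1 / (2 * q))) ^ 4 \<le> matrix_w (2 * q) n H ^ 4"
    by (intro power_mono) auto
  moreover have "(S powr (1 / (2 * q))) ^ 4 = S powr (2 / q)"
    using S q by (cases "S = 0") (simp_all add: powr_power)
  ultimately have Sw: "S powr (2 / q) \<le> matrix_w (2 * q) n H ^ 4" by simp
  have "cmod (cross_trace n H Q1 Q2 Q3 (Q ** diagm (\<lambda>k. of_real (d k)) ** Q'))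
    \<le> (\<Sum>k\<in>UNIV. s k powr (1 / (2 / q))) powr (2 / q)
      * (\<Sum>k\<in>UNIV. d k powr (1 / ((q - 2) / q))) powr ((q - 2) / q)"
    unfolding cross_trace_eq
    using q by (intro trace_duality[OF Ps(1,3,2) d Q(4,5)]) (auto simp: field_simps)
  also have "\<dots> \<le> matrix_w (2 * q) n H ^ 4 * (\<Sum>k\<in>UNIV. d k powr (q / (q - 2))) powr ((q - 2) / q)"
    using Sw by (intro mult_mono) (auto simp: S_def)
  finally show ?thesis .
qed

section \<open>Complex interpolation\<close>

text \<open>The Gaussian factor makes a function bounded on the strip decay at the far ends, so that the
  maximum principle on a tall rectangle applies.\<close>
lemma strip_maximum:
  fixes g :: "complex \<Rightarrow> complex"
  assumes hol: "g holomorphic_on UNIV"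
    and C: "\<And>z. 0 \<le> Re z \<Longrightarrow> Re z \<le> L \<Longrightarrow> cmod (g z) \<le> C"
    and K: "\<And>z. Re z = 0 \<or> Re z = L \<Longrightarrow> cmod (g z) \<le> K"
    and z0: "0 \<le> Re z0" "Re z0 \<le> L"
  shows "cmod (g z0) \<le> K"
proof -
  have K0: "0 \<le> K" using K[of 0] by (auto intro: order_trans[OF norm_ge_zero])
  have C0: "0 \<le> C" using C[OF z0] by (auto intro: order_trans[OF norm_ge_zero])
  have bound: "cmod (g z0) * exp (e * ((Re z0)\<^sup>2 - (Im z0)\<^sup>2)) \<le> (K + e) * exp (e * L\<^sup>2)"
    if e: "0 < e" for e
  proof -
    define h where "h = (\<lambda>z. g z * exp (of_real e * z\<^sup>2))"
    have cmod_h: "cmod (h z) = cmod (g z) * exp (e * ((Re z)\<^sup>2 - (Im z)\<^sup>2))" for z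
      by (simp add: h_def norm_mult norm_exp_eq_Re Re_power2)
    \<comment> \<open>Large enough for the Gaussian decay on the horizontal edges to beat C: C / e^2
      \<le> R^2 and x \<le> exp x give C exp (- e R^2) \<le> e.\<close>
    define R where "R = 1 + \<bar>Im z0\<bar> + C / e\<^sup>2"
    have "1 \<le> R" "C / e\<^sup>2 \<le> R" "\<bar>Im z0\<bar> \<le> R" using C0 e by (auto simp: R_def)
    then have "C / e\<^sup>2 \<le> R\<^sup>2" using self_le_power[of R 2] by linarith
    then have "C \<le> e * (e * R\<^sup>2)" using e by (simp add: field_simps power2_eq_square)
    moreover have "e * R\<^sup>2 \<le> exp (e * R\<^sup>2)"
      using exp_ge_add_one_self[of "e * R\<^sup>2"] by linarith
    then have "e * (e * R\<^sup>2) \<le> e * exp (e * R\<^sup>2)"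
      using e by (intro mult_left_mono) auto
    ultimately have CR: "C * exp (- (e * R\<^sup>2)) \<le> e" by (simp add: exp_minus field_simps)
    define S where "S = cbox (Complex 0 (- R)) (Complex L R)"
    have "cmod (h z0) \<le> (K + e) * exp (e * L\<^sup>2)"
    proof (rule maximum_modulus_frontier[where S = S and f = h])
      have h: "h holomorphic_on A" for A
        unfolding h_def by (intro holomorphic_intros holomorphic_on_subset[OF hol]) auto
      then show "h holomorphic_on interior S" "continuous_on (closure S) h"
        by (auto intro: holomorphic_on_imp_continuous_on)
      show "bounded S" by (simp add: S_def bounded_cbox)
      show "z0 \<in> S" using z0 \<open>\<bar>Im z0\<bar> \<le> R\<close> by (auto simp: S_def in_cbox_complex_iff)
    next
      fix z assume "z \<in> frontier S"
      then have z: "0 \<le> Re z" "Re z \<le> L" and edge: "Re z = 0 \<or> Re z = L \<or> \<bar>Im z\<bar> = R"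
        by (auto simp: S_def frontier_cbox in_cbox_complex_iff in_box_complex_iff)
      have Re2: "(Re z)\<^sup>2 \<le> L\<^sup>2" using z by (intro power_mono)
      show "cmod (h z) \<le> (K + e) * exp (e * L\<^sup>2)"
      proof (cases "Re z = 0 \<or> Re z = L")
        case True
        then show ?thesis unfolding cmod_h
          using e K0 Re2 K[of z] by (intro mult_mono) (auto intro: order_trans)
      next
        case False
        then have Im: "(Im z)\<^sup>2 = R\<^sup>2" using edge by (metis power2_abs)
        have "cmod (h z) \<le> C * exp (e * ((Re z)\<^sup>2 - R\<^sup>2))"
          unfolding cmod_h Im using C[OF z] by (intro mult_right_mono) auto
        also have "\<dots> = C * exp (- (e * R\<^sup>2)) * exp (e * (Re z)\<^sup>2)"
          by (simp add: exp_add[symmetric] algebra_simps flip: exp_add)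
        also have "\<dots> \<le> (K + e) * exp (e * L\<^sup>2)"
          using CR K0 e Re2 by (intro mult_mono) auto
        finally show ?thesis .
      qed
    qed
    then show ?thesis unfolding cmod_h .
  qed
  have "((\<lambda>e. cmod (g z0) * exp (e * ((Re z0)\<^sup>2 - (Im z0)\<^sup>2))) \<longlongrightarrow> cmod (g z0) * exp (0 * ((Re z0)\<^sup>2 - (Im z0)\<^sup>2)))
      (at_right 0)"
    by (intro tendsto_intros)
  moreover have "((\<lambda>e. (K + e) * exp (e * L\<^sup>2)) \<longlongrightarrow> (K + 0) * exp (0 * L\<^sup>2)) (at_right 0)"
    by (intro tendsto_intros)
  moreover have "eventually (\<lambda>e. cmod (g z0) * exp (e * ((Re z0)\<^sup>2 - (Im z0)\<^sup>2)) \<le> (K + e) * exp (e * L\<^sup>2)) (at_right 0)"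
    using eventually_at_right_less[of "0::real"] by eventually_elim (rule bound)
  ultimately show ?thesis
    using tendsto_le[OF trivial_limit_at_right_real] by fastforce
qed

section \<open>Entire functions bounded on a strip\<close>

definition strip_bounded :: "real \<Rightarrow> (complex \<Rightarrow> complex) \<Rightarrow> bool" where
  "strip_bounded L g \<longleftrightarrow> g holomorphic_on UNIV \<and>
    (\<exists>C. \<forall>z. 0 \<le> Re z \<longrightarrow> Re z \<le> L \<longrightarrow> cmod (g z) \<le> C)"

lemma strip_bounded_const: "strip_bounded L (\<lambda>z. c)"
  unfolding strip_bounded_def by auto

lemma strip_bounded_add:
  assumes "strip_bounded L f" "strip_bounded L g"
  shows "strip_bounded L (\<lambda>z. f z + g z)"
proof -
  obtain a b where ab: "\<And>z. 0 \<le> Re z \<Longrightarrow> Re z \<le> L \<Longrightarrow> cmod (f z) \<le> a"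
    "\<And>z. 0 \<le> Re z \<Longrightarrow> Re z \<le> L \<Longrightarrow> cmod (g z) \<le> b"
    using assms unfolding strip_bounded_def by metis
  have "cmod (f z + g z) \<le> a + b" if "0 \<le> Re z" "Re z \<le> L" for z
    using ab[OF that] norm_triangle_ineq[of "f z" "g z"] by linarith
  then show ?thesis
    using assms unfolding strip_bounded_def by (blast intro: holomorphic_on_add)
qed

lemma strip_bounded_mult:
  assumes "strip_bounded L f" "strip_bounded L g"
  shows "strip_bounded L (\<lambda>z. f z * g z)"
proof -
  obtain a b where ab: "\<And>z. 0 \<le> Re z \<Longrightarrow> Re z \<le> L \<Longrightarrow> cmod (f z) \<le> a"
    "\<And>z. 0 \<le> Re z \<Longrightarrow> Re z \<le> L \<Longrightarrow> cmod (g z) \<le> b"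
    using assms unfolding strip_bounded_def by metis
  have "cmod (f z * g z) \<le> a * b" if "0 \<le> Re z" "Re z \<le> L" for z
    using ab[OF that] order_trans[OF norm_ge_zero ab(1)[OF that]]
    unfolding norm_mult by (intro mult_mono) auto
  then show ?thesis
    using assms unfolding strip_bounded_def by (blast intro: holomorphic_on_mult)
qed

lemma strip_bounded_sum:
  "(\<And>i. i \<in> I \<Longrightarrow> strip_bounded L (f i)) \<Longrightarrow> strip_bounded L (\<lambda>z. \<Sum>i\<in>I. f i z)"
  by (induction I rule: infinite_finite_induct) (auto simp: strip_bounded_const strip_bounded_add)

lemma strip_bounded_exp: "strip_bounded L (\<lambda>z. exp ((of_real a + of_real b * z) * of_real c))"
proof -
  have "cmod (exp ((of_real a + of_real b * z) * of_real c)) \<le> exp (\<bar>a * c\<bar> + \<bar>b * c\<bar> * L)"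
    if "0 \<le> Re z" "Re z \<le> L" for z
  proof -
    have "(a + b * Re z) * c = a * c + (b * c) * Re z" by (simp add: algebra_simps)
    also have "\<dots> \<le> \<bar>a * c\<bar> + \<bar>b * c\<bar> * L"
      using that by (intro add_mono order_trans[OF mult_right_mono[OF abs_ge_self] mult_left_mono]) auto
    finally show ?thesis by (simp add: norm_exp_eq_Re)
  qed
  then show ?thesis unfolding strip_bounded_def by (auto intro!: holomorphic_intros)
qed

definition strip_bounded_matrix :: "real \<Rightarrow> (complex \<Rightarrow> complex^'n^'m) \<Rightarrow> bool" where
  "strip_bounded_matrix L F \<longleftrightarrow> (\<forall>i j. strip_bounded L (\<lambda>z. F z $ i $ j))"

lemma strip_bounded_matrix_const: "strip_bounded_matrix L (\<lambda>z. A)"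
  by (simp add: strip_bounded_matrix_def strip_bounded_const)

lemma strip_bounded_matrix_mult:
  "strip_bounded_matrix L F \<Longrightarrow> strip_bounded_matrix L G \<Longrightarrow> strip_bounded_matrix L (\<lambda>z. F z ** G z)"
  unfolding strip_bounded_matrix_def matrix_mult_component
  by (intro allI strip_bounded_sum strip_bounded_mult) auto

lemma strip_bounded_trace: "strip_bounded_matrix L F \<Longrightarrow> strip_bounded L (\<lambda>z. trace (F z))"
  unfolding strip_bounded_matrix_def trace_def by (intro strip_bounded_sum) auto

section \<open>Complex powers and interpolation of crossing traces\<close>

text \<open>Written with exp, the power is entire in z, turns sums of exponents into products, and
  is unitary on the imaginary axis. Interpolation uses these three properties.\<close>

definition diag_cpow :: "('n \<Rightarrow> real) \<Rightarrow> complex \<Rightarrow> complex^'n^'n" where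
  "diag_cpow d z = diagm (\<lambda>k. exp (z * of_real (ln (d k))))"

lemma diag_cpow_add: "diag_cpow d (z + w) = diag_cpow d z ** diag_cpow d w"
  by (simp add: diag_cpow_def diagm_mult distrib_right exp_add)

lemma unitary_diag_cpow: "Re z = 0 \<Longrightarrow> unitary_matrix (diag_cpow d z)"
  unfolding diag_cpow_def by (rule unitary_diagm) (simp add: norm_exp_eq_Re)

lemma diag_cpow_of_real:
  assumes "\<And>k. 0 < d k"
  shows "diag_cpow d (of_real t) = diagm (\<lambda>k. of_real (d k powr t))"
  using assms by (simp add: diag_cpow_def powr_def less_imp_neq[symmetric] flip: exp_of_real)

lemma strip_bounded_diag_cpow:
  "strip_bounded_matrix L (\<lambda>z. diag_cpow d (of_real a + of_real b * z))"
  unfolding strip_bounded_matrix_def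
proof (intro allI)
  show "strip_bounded L (\<lambda>z. diag_cpow d (of_real a + of_real b * z) $ i $ j)" for i j
    by (cases "i = j") (simp_all add: diag_cpow_def diagm_def strip_bounded_exp strip_bounded_const)
qed

lemma strip_bounded_cross_trace:
  assumes "strip_bounded_matrix L Y1" "strip_bounded_matrix L Y2"
    "strip_bounded_matrix L Y3" "strip_bounded_matrix L Y4"
  shows "strip_bounded L (\<lambda>z. cross_trace n H (Y1 z) (Y2 z) (Y3 z) (Y4 z))"
  unfolding cross_trace_def
  by (intro strip_bounded_sum strip_bounded_trace strip_bounded_matrix_mult
      strip_bounded_matrix_const assms)

lemma cross_trace_strip:
  assumes Y: "strip_bounded_matrix L Y1" "strip_bounded_matrix L Y2"
    "strip_bounded_matrix L Y3" "strip_bounded_matrix L Y4"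
    and K: "\<And>z. Re z = 0 \<or> Re z = L \<Longrightarrow> cmod (cross_trace n H (Y1 z) (Y2 z) (Y3 z) (Y4 z)) \<le> K"
    and t: "0 \<le> t" "t \<le> L"
  shows "cmod (cross_trace n H (Y1 (of_real t)) (Y2 (of_real t)) (Y3 (of_real t)) (Y4 (of_real t))) \<le> K"
proof -
  from strip_bounded_cross_trace[OF Y, of n H]
  obtain C where "(\<lambda>z. cross_trace n H (Y1 z) (Y2 z) (Y3 z) (Y4 z)) holomorphic_on UNIV"
    "\<And>z. 0 \<le> Re z \<Longrightarrow> Re z \<le> L \<Longrightarrow> cmod (cross_trace n H (Y1 z) (Y2 z) (Y3 z) (Y4 z)) \<le> C"
    unfolding strip_bounded_def by blast
  from strip_maximum[where L = L, OF this K, of "of_real t"] t show ?thesis by simp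
qed

text \<open>The three lines theorem along an edge of the simplex of exponents, with the same bound K
  at both ends: on each boundary line one of the two powers is unitary and the other is the full
  power times a unitary matrix, which the surrounding unitary factors absorb.\<close>

lemma cross_trace_two_powers:
  assumes vertex: "\<And>Q1 Q2 Q3 Q Q'. unitary_matrix Q1 \<Longrightarrow> unitary_matrix Q2 \<Longrightarrow> unitary_matrix Q3 \<Longrightarrow>
      unitary_matrix Q \<Longrightarrow> unitary_matrix Q' \<Longrightarrow>
      cmod (cross_trace n H Q1 Q2 Q3 (Q ** diag_cpow d (of_real s) ** Q')) \<le> K"
    and bc: "0 \<le> b" "0 \<le> c" "b + c = s"
    and U: "unitary_matrix Q1" "unitary_matrix Q2" "unitary_matrix Q3" "unitary_matrix Q3'"
      "unitary_matrix Q4" "unitary_matrix Q4'"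
  shows "cmod (cross_trace n H Q1 Q2 (Q3 ** diag_cpow d (of_real b) ** Q3')
    (Q4 ** diag_cpow d (of_real c) ** Q4')) \<le> K"
proof -
  define Y3 where "Y3 = (\<lambda>z. Q3 ** diag_cpow d (of_real 0 + of_real 1 * z) ** Q3')"
  define Y4 where "Y4 = (\<lambda>z. Q4 ** diag_cpow d (of_real s + of_real (- 1) * z) ** Q4')"
  have "cmod (cross_trace n H Q1 Q2 (Y3 (of_real b)) (Y4 (of_real b))) \<le> K"
  proof (rule cross_trace_strip[where L = s])
    show "strip_bounded_matrix s Y3" "strip_bounded_matrix s Y4"
      unfolding Y3_def Y4_def
      by (intro strip_bounded_matrix_mult strip_bounded_diag_cpow strip_bounded_matrix_const)+
    fix z :: complex
    assume "Re z = 0 \<or> Re z = s"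
    then show "cmod (cross_trace n H Q1 Q2 (Y3 z) (Y4 z)) \<le> K"
    proof
      assume z: "Re z = 0"
      have "Y4 z = Q4 ** diag_cpow d (of_real s) ** (diag_cpow d (- z) ** Q4')"
        by (simp add: Y4_def matrix_mul_assoc diag_cpow_add[of d "of_real s" "- z", simplified])
      then show ?thesis
        using z U by (simp add: vertex Y3_def unitary_mult unitary_diag_cpow)
    next
      \<comment> \<open>Here the full power sits in the third slot; a rotation brings it to the
        last.\<close>
      assume z: "Re z = s"
      have "Y3 z = Q3 ** diag_cpow d (of_real s) ** (diag_cpow d (z - of_real s) ** Q3')"
        using diag_cpow_add[of d "of_real s" "z - of_real s"] by (simp add: Y3_def matrix_mul_assoc)
      moreover have "unitary_matrix (Y4 z)"
        using z U by (simp add: Y4_def unitary_mult unitary_diag_cpow)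
      ultimately show ?thesis
        using z U cross_trace_rotate[of n H "Y4 z" Q1 Q2 "Y3 z"]
        by (metis vertex unitary_mult unitary_diag_cpow minus_complex.simps(1) Re_complex_of_real diff_self)
    qed
  qed (use bc in \<open>auto simp: strip_bounded_matrix_const\<close>)
  moreover have "complex_of_real c = of_real s - of_real b"
    using bc(3) by (simp flip: of_real_diff)
  ultimately show ?thesis by (simp add: Y3_def Y4_def)
qed

text \<open>The exponents move along the line from a vertex of the simplex through \<open>(a, b, c)\<close> to the
  opposite edge.\<close>
lemma cross_trace_three_powers:
  assumes vertex: "\<And>Q1 Q2 Q3 Q Q'. unitary_matrix Q1 \<Longrightarrow> unitary_matrix Q2 \<Longrightarrow> unitary_matrix Q3 \<Longrightarrow>
      unitary_matrix Q \<Longrightarrow> unitary_matrix Q' \<Longrightarrow>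
      cmod (cross_trace n H Q1 Q2 Q3 (Q ** diag_cpow d (of_real s) ** Q')) \<le> K"
    and abc: "0 \<le> a" "0 \<le> b" "0 \<le> c" "0 < b + c" "a + b + c = s"
    and U: "unitary_matrix Q1" "unitary_matrix Q2" "unitary_matrix Q2'" "unitary_matrix Q3"
      "unitary_matrix Q3'" "unitary_matrix Q4" "unitary_matrix Q4'"
  shows "cmod (cross_trace n H Q1 (Q2 ** diag_cpow d (of_real a) ** Q2')
    (Q3 ** diag_cpow d (of_real b) ** Q3') (Q4 ** diag_cpow d (of_real c) ** Q4')) \<le> K"
proof -
  define m where "m = b + c"
  have m: "0 < m" "s - a = m" using abc by (auto simp: m_def)
  \<comment> \<open>The exponents are z, b (s - z) / m and c (s - z) / m. At z = a they are a, b, c.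
    On Re z = 0 the last two have real parts adding up to s, and on Re z = s only the first has a
    nonzero real part.\<close>
  define Y2 where "Y2 = (\<lambda>z. Q2 ** diag_cpow d (of_real 0 + of_real 1 * z) ** Q2')"
  define Y3 where "Y3 = (\<lambda>z. Q3 ** diag_cpow d (of_real (s * b / m) + of_real (- b / m) * z) ** Q3')"
  define Y4 where "Y4 = (\<lambda>z. Q4 ** diag_cpow d (of_real (s * c / m) + of_real (- c / m) * z) ** Q4')"
  have "cmod (cross_trace n H Q1 (Y2 (of_real a)) (Y3 (of_real a)) (Y4 (of_real a))) \<le> K"
  proof (rule cross_trace_strip[where L = s])
    show "strip_bounded_matrix s Y2" "strip_bounded_matrix s Y3" "strip_bounded_matrix s Y4"
      unfolding Y2_def Y3_def Y4_def
      by (intro strip_bounded_matrix_mult strip_bounded_diag_cpow strip_bounded_matrix_const)+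
    fix z :: complex
    assume "Re z = 0 \<or> Re z = s"
    then show "cmod (cross_trace n H Q1 (Y2 z) (Y3 z) (Y4 z)) \<le> K"
    proof
      assume z: "Re z = 0"
      have Y2: "unitary_matrix (Y2 z)"
        using z U by (simp add: Y2_def unitary_mult unitary_diag_cpow)
      have Y3: "Y3 z = Q3 ** diag_cpow d (of_real (s * b / m)) ** (diag_cpow d (of_real (- b / m) * z) ** Q3')"
        unfolding Y3_def diag_cpow_add by (simp add: matrix_mul_assoc)
      have Y4: "Y4 z = Q4 ** diag_cpow d (of_real (s * c / m)) ** (diag_cpow d (of_real (- c / m) * z) ** Q4')"
        unfolding Y4_def diag_cpow_add by (simp add: matrix_mul_assoc)
      have sum: "s * b / m + s * c / m = s"
        using m by (simp add: m_def flip: add_divide_distrib distrib_left)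
      show ?thesis unfolding Y3 Y4
        by (rule cross_trace_two_powers[OF vertex])
          (use m z U Y2 abc sum in \<open>auto intro!: unitary_mult unitary_diag_cpow\<close>)
    next
      assume z: "Re z = s"
      have "Y2 z = Q2 ** diag_cpow d (of_real s) ** (diag_cpow d (z - of_real s) ** Q2')"
        using diag_cpow_add[of d "of_real s" "z - of_real s"] by (simp add: Y2_def matrix_mul_assoc)
      moreover have "unitary_matrix (Y3 z)" "unitary_matrix (Y4 z)"
        using z U m by (auto simp: Y3_def Y4_def intro!: unitary_mult unitary_diag_cpow)
      moreover have "unitary_matrix (diag_cpow d (z - of_real s) ** Q2')"
        using z U by (intro unitary_mult unitary_diag_cpow) auto
      moreover have "cross_trace n H Q1 (Y2 z) (Y3 z) (Y4 z) = cross_trace n H (Y3 z) (Y4 z) Q1 (Y2 z)"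
        by (metis cross_trace_rotate)
      ultimately show ?thesis using U by (simp add: vertex)
    qed
  qed (use abc in \<open>auto simp: strip_bounded_matrix_const\<close>)
  moreover have "s * b / m - b * a / m = b" "s * c / m - c * a / m = c"
    using m by (auto simp: field_simps)
  ultimately show ?thesis
    by (simp add: Y2_def Y3_def Y4_def flip: of_real_diff of_real_mult of_real_divide)
qed

text \<open>Complex powers need positive eigenvalues, whereas odd powers of X carry signs. The signs
  go into a diagonal factor with entries 1 and -1, unitary because no eigenvalue is 0.\<close>

lemma conj_rdiag_power_eq:
  assumes "\<And>k. x k \<noteq> 0"
  shows "conj_rdiag U (\<lambda>k. x k ^ a)
    = U ** diagm (\<lambda>k. of_real (sgn (x k) ^ a)) ** diag_cpow (\<lambda>k. \<bar>x k\<bar>) (of_real (real a)) ** cadjoint U"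
proof -
  have "x k ^ a = sgn (x k) ^ a * \<bar>x k\<bar> powr real a" for k
    using assms[of k] by (simp add: powr_realpow sgn_mult_abs flip: power_mult_distrib)
  then have "diagm (\<lambda>k. of_real (x k ^ a))
      = diagm (\<lambda>k. of_real (sgn (x k) ^ a)) ** diagm (\<lambda>k. of_real (\<bar>x k\<bar> powr real a))"
    unfolding diagm_mult by simp
  moreover have "0 < \<bar>x k\<bar>" for k using assms[of k] by simp
  ultimately show ?thesis
    by (simp only: conj_diag_def diag_cpow_of_real[of "\<lambda>k. \<bar>x k\<bar>"] matrix_mul_assoc)
qed

lemma cross_trace_powers_invertible:
  fixes H :: "nat \<Rightarrow> complex^'d^'d"
  assumes p: "3 \<le> p" and r: "r \<le> 2 * p - 5" and U: "unitary_matrix U" and x: "\<And>k. x k \<noteq> 0"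
  shows "cmod (cross_trace n H (mat 1) (conj_rdiag U x) (conj_rdiag U (\<lambda>k. x k ^ r))
      (conj_rdiag U (\<lambda>k. x k ^ (2 * p - 5 - r))))
    \<le> matrix_w (2 * real p) n H ^ 4 * (\<Sum>k\<in>UNIV. \<bar>x k\<bar> ^ (2 * p)) powr ((real p - 2) / real p)"
    (is "_ \<le> ?K")
proof -
  define d where "d = (\<lambda>k. \<bar>x k\<bar>)"
  \<comment> \<open>The total power of X in a crossing term. Since s p / (p - 2) = 2p, the dual norm
    of |X|^s is a power of tr X^(2p).\<close>
  define s where "s = 2 * real p - 4"
  have d: "0 < d k" for k using x by (simp add: d_def)
  have q: "2 < real p" using p by simp
  have vertex: "cmod (cross_trace n H Q1 Q2 Q3 (Q ** diag_cpow d (of_real s) ** Q')) \<le> ?K"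
    if "unitary_matrix Q1" "unitary_matrix Q2" "unitary_matrix Q3" "unitary_matrix Q" "unitary_matrix Q'"
    for Q1 Q2 Q3 Q Q'
  proof -
    have "(d k powr s) powr (real p / (real p - 2)) = \<bar>x k\<bar> ^ (2 * p)" for k
    proof -
      have "s * (real p / (real p - 2)) = real (2 * p)"
        using q by (simp add: s_def field_simps)
      then show ?thesis using d[of k] by (simp only: powr_powr powr_realpow d_def)
    qed
    with cross_trace_one_diagonal[OF q that, of "\<lambda>k. d k powr s" n H]
    show ?thesis by (simp add: diag_cpow_of_real[OF d])
  qed
  have unit: "unitary_matrix (U ** diagm (\<lambda>k. of_real (sgn (x k) ^ a)))" for a
    using x by (intro unitary_mult U unitary_diagm) (simp add: norm_power abs_sgn_eq)
  have "conj_rdiag U x = conj_rdiag U (\<lambda>k. x k ^ 1)" by simp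
  moreover have "real 1 + real r + real (2 * p - 5 - r) = s"
    using p r by (simp add: s_def of_nat_diff)
  \<comment> \<open>As 2p - 5 > 0, the last two exponents do not both vanish;
    \<open>cross_trace_three_powers\<close> divides by their sum.\<close>
  moreover have "0 < real r + real (2 * p - 5 - r)" using p by auto
  ultimately show ?thesis
    unfolding conj_rdiag_power_eq[OF x] d_def[symmetric]
    by (simp only: conj_rdiag_power_eq[OF x] d_def[symmetric])
      (intro cross_trace_three_powers[OF vertex] unit unitary_cadjoint U unitary_mat1, auto)
qed

lemma tendsto_cross_trace:
  assumes "(Y1 \<longlongrightarrow> Z1) F" "(Y2 \<longlongrightarrow> Z2) F" "(Y3 \<longlongrightarrow> Z3) F" "(Y4 \<longlongrightarrow> Z4) F"
  shows "((\<lambda>e. cross_trace n H (Y1 e) (Y2 e) (Y3 e) (Y4 e)) \<longlongrightarrow> cross_trace n H Z1 Z2 Z3 Z4) F"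
  unfolding cross_trace_def trace_def
  by (intro tendsto_sum tendsto_vec_nth mmult.tendsto tendsto_const assms)

lemma tendsto_conj_rdiag:
  assumes "\<And>k. ((\<lambda>e. f e k) \<longlongrightarrow> g k) F"
  shows "((\<lambda>e. conj_rdiag U (f e)) \<longlongrightarrow> conj_rdiag U g) F"
proof -
  have "((\<lambda>e. diagm (\<lambda>k. complex_of_real (f e k)) $ i $ j) \<longlongrightarrow> diagm (\<lambda>k. complex_of_real (g k)) $ i $ j) F" for i j
    by (cases "i = j") (auto simp: diagm_def intro!: tendsto_intros assms)
  then have "((\<lambda>e. diagm (\<lambda>k. complex_of_real (f e k))) \<longlongrightarrow> diagm (\<lambda>k. complex_of_real (g k))) F"
    by (intro vec_tendstoI)
  then show ?thesis
    unfolding conj_diag_def by (intro mmult.tendsto tendsto_const)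
qed

text \<open>Zero eigenvalues are replaced by \<open>e > 0\<close>, and \<open>e\<close> tends to \<open>0\<close>.\<close>
lemma cross_trace_powers:
  fixes H :: "nat \<Rightarrow> complex^'d^'d"
  assumes p: "3 \<le> p" and r: "r \<le> 2 * p - 5" and X: "hermitian_matrix X"
  shows "cmod (cross_trace n H (mat 1) X (mpow X r) (mpow X (2 * p - 5 - r)))
    \<le> matrix_w (2 * real p) n H ^ 4 * Re (trace (mpow X (2 * p))) powr ((real p - 2) / real p)"
proof -
  obtain U and x :: "'d \<Rightarrow> real" where U: "unitary_matrix U" and X: "X = conj_rdiag U x"
    using X by (rule hermitian_spectral)
  define y where "y = (\<lambda>e k. if x k = 0 then e else x k)"
  have y: "((\<lambda>e. y e k) \<longlongrightarrow> x k) (at_right 0)" for k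
    by (cases "x k = 0") (auto simp: y_def)
  have lhs: "((\<lambda>e. cmod (cross_trace n H (mat 1) (conj_rdiag U (y e)) (conj_rdiag U (\<lambda>k. y e k ^ r))
      (conj_rdiag U (\<lambda>k. y e k ^ (2 * p - 5 - r))))) \<longlongrightarrow>
      cmod (cross_trace n H (mat 1) (conj_rdiag U x) (conj_rdiag U (\<lambda>k. x k ^ r))
      (conj_rdiag U (\<lambda>k. x k ^ (2 * p - 5 - r))))) (at_right 0)"
    by (intro tendsto_norm tendsto_cross_trace tendsto_const tendsto_conj_rdiag tendsto_power y)
  \<comment> \<open>A positive exponent makes powr continuous at 0, so the limit is also correct
    when the sum tends to 0.\<close>
  have pos: "0 < (real p - 2) / real p" using p by simp
  have rhs: "((\<lambda>e. matrix_w (2 * real p) n H ^ 4 * (\<Sum>k\<in>UNIV. \<bar>y e k\<bar> ^ (2 * p)) powr ((real p - 2) / real p)) \<longlongrightarrow>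
      matrix_w (2 * real p) n H ^ 4 * (\<Sum>k\<in>UNIV. \<bar>x k\<bar> ^ (2 * p)) powr ((real p - 2) / real p)) (at_right 0)"
    by (intro tendsto_mult tendsto_const tendsto_powr' tendsto_sum tendsto_power tendsto_rabs y)
      (use pos in \<open>auto intro!: always_eventually sum_nonneg\<close>)
  have "eventually (\<lambda>e. cmod (cross_trace n H (mat 1) (conj_rdiag U (y e)) (conj_rdiag U (\<lambda>k. y e k ^ r))
      (conj_rdiag U (\<lambda>k. y e k ^ (2 * p - 5 - r))))
      \<le> matrix_w (2 * real p) n H ^ 4 * (\<Sum>k\<in>UNIV. \<bar>y e k\<bar> ^ (2 * p)) powr ((real p - 2) / real p)) (at_right 0)"
    using eventually_at_right_less[of "0::real"]
    by eventually_elim (rule cross_trace_powers_invertible[OF p r U], simp add: y_def)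
  from tendsto_le[OF trivial_limit_at_right_real rhs lhs this]
  show ?thesis
    unfolding X trace_mpow_even_eq[OF U] by (simp add: mpow_conj_diag[OF U])
qed

section \<open>Gaussian integration by parts\<close>

text \<open>Integration by parts for a monomial, read off from the closed form of the moments: for
  even k both sides vanish, for odd k it is the recursion of the factorial quotients. For k = 0 the
  factor k hides the truncated k - 1.\<close>

lemma std_normal_moment_Suc:
  "(\<integral>x. std_normal_density x * x ^ Suc k \<partial>lborel)
    = real k * (\<integral>x. std_normal_density x * x ^ (k - 1) \<partial>lborel)"
proof (cases "even k")
  case True
  then obtain j where k: "k = 2 * j" by (elim evenE)
  show ?thesis
  proof (cases j)
    case 0
    then show ?thesis using integral_std_normal_moment_odd[of 0] k by simp
  next
    case (Suc i)
    then show ?thesis using integral_std_normal_moment_odd[of j] integral_std_normal_moment_odd[of i] k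
      by simp
  qed
next
  case False
  then obtain j where k: "k = 2 * j + 1" by (elim oddE)
  then have Suc_k: "Suc k = 2 * Suc j" by simp
  have f: "(fact (2 * Suc j) :: real) = 2 * (real j + 1) * ((2 * real j + 1) * fact (2 * j))"
    "(fact (Suc j) :: real) = (real j + 1) * fact j"
    by (simp_all add: algebra_simps)
  have "fact (2 * Suc j) / (2 ^ Suc j * fact (Suc j))
      = (2 * real j + 1) * (fact (2 * j) / (2 ^ j * fact j))"
    unfolding f by (simp add: divide_simps add_nonneg_eq_0_iff)
  then show ?thesis
    unfolding Suc_k integral_std_normal_moment_even
    using integral_std_normal_moment_even[of j] k by simp
qed

locale std_gaussian_family = prob_space M for M :: "'a measure" +
  fixes n :: nat and \<gamma> :: "nat \<Rightarrow> 'a \<Rightarrow> real"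
  assumes indep: "indep_vars (\<lambda>_. borel) \<gamma> {1..n}"
    and normal: "\<And>i. i \<in> {1..n} \<Longrightarrow> distributed M lborel (\<gamma> i) std_normal_density"
begin

lemma gaussian_power:
  assumes "i \<in> {1..n}"
  shows integrable_gaussian_power: "integrable M (\<lambda>\<omega>. \<gamma> i \<omega> ^ k)"
    and gaussian_moment_Suc: "expectation (\<lambda>\<omega>. \<gamma> i \<omega> ^ Suc k) = k * expectation (\<lambda>\<omega>. \<gamma> i \<omega> ^ (k - 1))"
proof -
  have int: "(\<integral>x. std_normal_density x * x ^ m \<partial>lborel) = expectation (\<lambda>\<omega>. \<gamma> i \<omega> ^ m)" for m
    by (rule distributed_integral[OF normal[OF assms]]) auto
  show "integrable M (\<lambda>\<omega>. \<gamma> i \<omega> ^ k)"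
    using distributed_integrable[OF normal[OF assms], of "\<lambda>x. x ^ k"] integrable_std_normal_moment[of k]
    by simp
  show "expectation (\<lambda>\<omega>. \<gamma> i \<omega> ^ Suc k) = k * expectation (\<lambda>\<omega>. \<gamma> i \<omega> ^ (k - 1))"
    using std_normal_moment_Suc[of k] by (simp only: int)
qed

section \<open>Stein's identity tested against monomials\<close>

definition gmono :: "(nat \<Rightarrow> nat) \<Rightarrow> 'a \<Rightarrow> real" where
  "gmono e \<omega> = (\<Prod>i\<in>{1..n}. \<gamma> i \<omega> ^ e i)"

lemma gmono_upd:
  "j \<in> {1..n} \<Longrightarrow> gmono (e(j := k)) \<omega> = \<gamma> j \<omega> ^ k * (\<Prod>i\<in>{1..n} - {j}. \<gamma> i \<omega> ^ e i)"
  unfolding gmono_def by (subst prod.remove[of _ j]) auto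

lemma coord_times_gmono: "j \<in> {1..n} \<Longrightarrow> \<gamma> j \<omega> * gmono e \<omega> = gmono (e(j := Suc (e j))) \<omega>"
  using gmono_upd[of j e "e j" \<omega>] gmono_upd[of j e "Suc (e j)" \<omega>] by simp

lemma gmono_moments:
  shows integrable_gmono: "integrable M (gmono e)"
    and expectation_gmono: "expectation (gmono e) = (\<Prod>i\<in>{1..n}. expectation (\<lambda>\<omega>. \<gamma> i \<omega> ^ e i))"
proof -
  have "indep_vars (\<lambda>_. borel) (\<lambda>i \<omega>. \<gamma> i \<omega> ^ e i) {1..n}"
    using indep by (rule indep_vars_compose2) auto
  from indep_vars_integrable[OF _ this] indep_vars_lebesgue_integral[OF _ this]
  show "integrable M (gmono e)"
    "expectation (gmono e) = (\<Prod>i\<in>{1..n}. expectation (\<lambda>\<omega>. \<gamma> i \<omega> ^ e i))"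
    by (simp_all add: integrable_gaussian_power gmono_def[abs_def])
qed

lemma expectation_gmono_Suc:
  assumes j: "j \<in> {1..n}"
  shows "expectation (gmono (e(j := Suc (e j)))) = e j * expectation (gmono (e(j := e j - 1)))"
proof -
  have "expectation (gmono (e(j := k))) =
      expectation (\<lambda>\<omega>. \<gamma> j \<omega> ^ k) * (\<Prod>i\<in>{1..n} - {j}. expectation (\<lambda>\<omega>. \<gamma> i \<omega> ^ e i))" for k
    unfolding expectation_gmono using j by (subst prod.remove[of _ j]) auto
  then show ?thesis by (simp only: gaussian_moment_Suc[OF j] mult.assoc)
qed

text \<open>\<open>D j\<close> is the partial derivative of \<open>F\<close> in the \<open>j\<close>-th Gaussian. Testing against all monomials
  makes the property stable under multiplication by a coordinate.\<close>
definition stein :: "('a \<Rightarrow> 'b::euclidean_space) \<Rightarrow> (nat \<Rightarrow> 'a \<Rightarrow> 'b) \<Rightarrow> bool" where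
  "stein F D \<longleftrightarrow> (\<forall>e. integrable M (\<lambda>\<omega>. gmono e \<omega> *\<^sub>R F \<omega>)) \<and>
    (\<forall>j\<in>{1..n}. \<forall>e. integrable M (\<lambda>\<omega>. gmono e \<omega> *\<^sub>R D j \<omega>) \<and>
      (\<integral>\<omega>. gmono (e(j := Suc (e j))) \<omega> *\<^sub>R F \<omega> \<partial>M)
      = e j *\<^sub>R (\<integral>\<omega>. gmono (e(j := e j - 1)) \<omega> *\<^sub>R F \<omega> \<partial>M) + (\<integral>\<omega>. gmono e \<omega> *\<^sub>R D j \<omega> \<partial>M))"

lemma steinD:
  assumes "stein F D"
  shows "integrable M (\<lambda>\<omega>. gmono e \<omega> *\<^sub>R F \<omega>)"
    and "j \<in> {1..n} \<Longrightarrow> integrable M (\<lambda>\<omega>. gmono e \<omega> *\<^sub>R D j \<omega>)"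
    and "j \<in> {1..n} \<Longrightarrow> (\<integral>\<omega>. gmono (e(j := Suc (e j))) \<omega> *\<^sub>R F \<omega> \<partial>M)
      = e j *\<^sub>R (\<integral>\<omega>. gmono (e(j := e j - 1)) \<omega> *\<^sub>R F \<omega> \<partial>M) + (\<integral>\<omega>. gmono e \<omega> *\<^sub>R D j \<omega> \<partial>M)"
  using assms unfolding stein_def by blast+

lemma stein_cong: "stein F D \<Longrightarrow> (\<And>j. j \<in> {1..n} \<Longrightarrow> D j = D' j) \<Longrightarrow> stein F D'"
  unfolding stein_def by simp

lemma stein_const: "stein (\<lambda>\<omega>. A) (\<lambda>j \<omega>. 0)"
  unfolding stein_def using integrable_gmono expectation_gmono_Suc
  by (simp add: fun_upd_def)

lemma stein_linear:
  assumes F: "stein F D" and L: "bounded_linear L"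
  shows "stein (\<lambda>\<omega>. L (F \<omega>)) (\<lambda>j \<omega>. L (D j \<omega>))"
proof -
  interpret L: bounded_linear L by (rule L)
  have "integrable M (\<lambda>\<omega>. c \<omega> *\<^sub>R L (f \<omega>))"
    "(\<integral>\<omega>. c \<omega> *\<^sub>R L (f \<omega>) \<partial>M) = L (\<integral>\<omega>. c \<omega> *\<^sub>R f \<omega> \<partial>M)"
    if "integrable M (\<lambda>\<omega>. c \<omega> *\<^sub>R f \<omega>)" for c :: "'a \<Rightarrow> real" and f
    using integrable_bounded_linear[OF L that] integral_bounded_linear[OF L that]
    by (simp_all add: L.scaleR)
  then show ?thesis
    using F unfolding stein_def by (simp add: L.add L.scaleR)
qed

lemma stein_add:
  assumes F: "stein F D" and G: "stein G E"
  shows "stein (\<lambda>\<omega>. F \<omega> + G \<omega>) (\<lambda>j \<omega>. D j \<omega> + E j \<omega>)"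
  using F G unfolding stein_def by (simp add: scaleR_add_right)

lemma stein_sum:
  assumes "\<And>i. i \<in> I \<Longrightarrow> stein (F i) (D i)"
  shows "stein (\<lambda>\<omega>. \<Sum>i\<in>I. F i \<omega>) (\<lambda>j \<omega>. \<Sum>i\<in>I. D i j \<omega>)"
  using assms
  by (induction I rule: infinite_finite_induct) (simp_all add: stein_const stein_add)

text \<open>The product rule for multiplication by a Gaussian. For i = j the extra coordinate raises
  the exponent e j by one, and the surplus in the new coefficient e j + 1 is the term F.\<close>

lemma stein_times_coord:
  assumes F: "stein F D" and i: "i \<in> {1..n}"
  shows "stein (\<lambda>\<omega>. \<gamma> i \<omega> *\<^sub>R F \<omega>) (\<lambda>j \<omega>. (if i = j then F \<omega> else 0) + \<gamma> i \<omega> *\<^sub>R D j \<omega>)"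
proof -
  note int = steinD(1)[OF F] and intD = steinD(2)[OF F] and S = steinD(3)[OF F]
  have shift: "gmono e \<omega> *\<^sub>R \<gamma> i \<omega> *\<^sub>R v = gmono (e(i := Suc (e i))) \<omega> *\<^sub>R v"
    for e \<omega> and v :: 'b
    using coord_times_gmono[OF i, of \<omega> e] by (simp add: mult.commute)
  have "integrable M (\<lambda>\<omega>. gmono e \<omega> *\<^sub>R ((if i = j then F \<omega> else 0) + \<gamma> i \<omega> *\<^sub>R D j \<omega>)) \<and>
      (\<integral>\<omega>. gmono (e(j := Suc (e j))) \<omega> *\<^sub>R \<gamma> i \<omega> *\<^sub>R F \<omega> \<partial>M)
      = e j *\<^sub>R (\<integral>\<omega>. gmono (e(j := e j - 1)) \<omega> *\<^sub>R \<gamma> i \<omega> *\<^sub>R F \<omega> \<partial>M)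
        + (\<integral>\<omega>. gmono e \<omega> *\<^sub>R ((if i = j then F \<omega> else 0) + \<gamma> i \<omega> *\<^sub>R D j \<omega>) \<partial>M)"
    if j: "j \<in> {1..n}" for e j
  proof (cases "i = j")
    case False
    have "e(j := Suc (e j), i := Suc ((e(j := Suc (e j))) i))
        = (e(i := Suc (e i)))(j := Suc ((e(i := Suc (e i))) j))"
      "e(j := e j - 1, i := Suc ((e(j := e j - 1)) i)) = (e(i := Suc (e i)))(j := (e(i := Suc (e i))) j - 1)"
      using False by auto
    then show ?thesis
      using False j intD[OF j] S[OF j, of "e(i := Suc (e i))"]
      by (simp add: shift del: scaleR_scaleR)
  next
    case True
    \<comment> \<open>For e j = 0 the truncated exponent e j - 1 is harmless, because its
      coefficient is 0.\<close>
    have 1: "e j *\<^sub>R (\<integral>\<omega>. gmono (e(j := e j - 1)) \<omega> *\<^sub>R \<gamma> i \<omega> *\<^sub>R F \<omega> \<partial>M) = e j *\<^sub>R (\<integral>\<omega>. gmono e \<omega> *\<^sub>R F \<omega> \<partial>M)"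
      unfolding shift using True by (cases "e j") (simp_all add: fun_upd_idem)
    have 2: "(\<integral>\<omega>. gmono (e(j := Suc (e j))) \<omega> *\<^sub>R \<gamma> i \<omega> *\<^sub>R F \<omega> \<partial>M)
        = Suc (e j) *\<^sub>R (\<integral>\<omega>. gmono e \<omega> *\<^sub>R F \<omega> \<partial>M) + (\<integral>\<omega>. gmono (e(j := Suc (e j))) \<omega> *\<^sub>R D j \<omega> \<partial>M)"
      using S[OF j, of "e(j := Suc (e j))"] True unfolding shift by simp
    have 3: "gmono e \<omega> *\<^sub>R ((if i = j then F \<omega> else 0) + \<gamma> i \<omega> *\<^sub>R D j \<omega>)
        = gmono e \<omega> *\<^sub>R F \<omega> + gmono (e(j := Suc (e j))) \<omega> *\<^sub>R D j \<omega>" for \<omega>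
      using True shift[of e \<omega> "D j \<omega>"] by (simp add: scaleR_add_right del: scaleR_scaleR)
    show ?thesis
      unfolding 1 2 3 using int intD[OF j] by (simp add: scaleR_add_left)
  qed
  moreover have "integrable M (\<lambda>\<omega>. gmono e \<omega> *\<^sub>R \<gamma> i \<omega> *\<^sub>R F \<omega>)" for e
    unfolding shift by (rule int)
  ultimately show ?thesis
    unfolding stein_def by simp
qed

lemma stein_left_mult:
  fixes F :: "'a \<Rightarrow> complex^'d^'d"
  shows "stein F D \<Longrightarrow> stein (\<lambda>\<omega>. A ** F \<omega>) (\<lambda>j \<omega>. A ** D j \<omega>)"
  by (rule stein_linear[OF _ mmult.bounded_linear_right])

lemma stein_integrable:
  assumes F: "stein F D"
  shows "integrable M F" "j \<in> {1..n} \<Longrightarrow> integrable M (D j)"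
  using steinD(1)[OF F, of "\<lambda>_. 0"] steinD(2)[OF F, of j "\<lambda>_. 0"] by (simp_all add: gmono_def)

lemma integrable_Re_trace:
  fixes F :: "'a \<Rightarrow> complex^'d^'d"
  assumes "integrable M F"
  shows "integrable M (\<lambda>\<omega>. Re (trace (A ** F \<omega>)))"
  by (rule integrable_bounded_linear[OF bounded_linear_compose[OF bounded_linear_Re_trace
          mmult.bounded_linear_right] assms])

section \<open>Derivatives of powers of the Gaussian matrix X\<close>

context
  fixes H :: "nat \<Rightarrow> complex^'d^'d" and X :: "'a \<Rightarrow> complex^'d^'d"
  assumes X: "\<And>\<omega>. X \<omega> = (\<Sum>i\<in>{1..n}. \<gamma> i \<omega> *\<^sub>R H i)"
begin

lemma stein_X_mult:
  fixes F :: "'a \<Rightarrow> complex^'d^'d"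
  assumes F: "stein F D"
  shows "stein (\<lambda>\<omega>. X \<omega> ** F \<omega>) (\<lambda>j \<omega>. H j ** F \<omega> + X \<omega> ** D j \<omega>)"
proof -
  have "stein (\<lambda>\<omega>. \<Sum>i\<in>{1..n}. \<gamma> i \<omega> *\<^sub>R (H i ** F \<omega>))
      (\<lambda>j \<omega>. \<Sum>i\<in>{1..n}. (if i = j then H i ** F \<omega> else 0) + \<gamma> i \<omega> *\<^sub>R (H i ** D j \<omega>))"
    by (intro stein_sum stein_times_coord stein_left_mult F)
  moreover have "X \<omega> ** A = (\<Sum>i\<in>{1..n}. \<gamma> i \<omega> *\<^sub>R (H i ** A))" for \<omega> and A :: "complex^'d^'d"
    by (simp add: X mmult.sum_left mmult.scaleR_left)
  ultimately have "stein (\<lambda>\<omega>. X \<omega> ** F \<omega>)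
      (\<lambda>j \<omega>. \<Sum>i\<in>{1..n}. (if i = j then H i ** F \<omega> else 0) + \<gamma> i \<omega> *\<^sub>R (H i ** D j \<omega>))"
    by simp
  then show ?thesis
    by (rule stein_cong)
      (simp add: sum.distrib X mmult.sum_left mmult.scaleR_left sum.delta[of _ _ "\<lambda>i. H i ** F _", simplified])
qed

lemma stein_mpow:
  "stein (\<lambda>\<omega>. mpow (X \<omega>) k) (\<lambda>j \<omega>. \<Sum>r<k. mpow (X \<omega>) r ** H j ** mpow (X \<omega>) (k - 1 - r))"
proof (induction k)
  case 0
  show ?case by (simp add: stein_const)
next
  case (Suc k)
  have "H j ** mpow (X \<omega>) k + X \<omega> ** (\<Sum>r<k. mpow (X \<omega>) r ** H j ** mpow (X \<omega>) (k - 1 - r))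
      = (\<Sum>r<Suc k. mpow (X \<omega>) r ** H j ** mpow (X \<omega>) (Suc k - 1 - r))" for j \<omega>
    unfolding sum.lessThan_Suc_shift by (simp add: mmult.sum_right matrix_mul_assoc)
  with stein_X_mult[OF Suc.IH] show ?case by simp
qed

text \<open>Expand the displayed factor X in the Gaussians and use Stein's identity with the
  constant monomial for each of them. The matrix A is deterministic, so the derivative falls on F
  alone.\<close>

lemma expectation_trace_X:
  fixes F :: "'a \<Rightarrow> complex^'d^'d"
  assumes F: "stein F D"
  shows "expectation (\<lambda>\<omega>. Re (trace (A ** X \<omega> ** F \<omega>)))
      = (\<Sum>j\<in>{1..n}. expectation (\<lambda>\<omega>. Re (trace (A ** H j ** D j \<omega>))))"
proof -
  have one: "(\<integral>\<omega>. \<gamma> j \<omega> *\<^sub>R F \<omega> \<partial>M) = (\<integral>\<omega>. D j \<omega> \<partial>M)"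
    and int: "integrable M (\<lambda>\<omega>. \<gamma> j \<omega> *\<^sub>R F \<omega>)" if "j \<in> {1..n}" for j
  proof -
    have "gmono ((\<lambda>_. 0)(j := Suc 0)) \<omega> = \<gamma> j \<omega>" "gmono (\<lambda>_. 0) \<omega> = 1" for \<omega>
      using coord_times_gmono[OF that, of \<omega> "\<lambda>_. 0"] by (simp_all add: gmono_def)
    then show "(\<integral>\<omega>. \<gamma> j \<omega> *\<^sub>R F \<omega> \<partial>M) = (\<integral>\<omega>. D j \<omega> \<partial>M)" "integrable M (\<lambda>\<omega>. \<gamma> j \<omega> *\<^sub>R F \<omega>)"
      using steinD(1)[OF F, of "(\<lambda>_. 0)(j := Suc 0)"] steinD(3)[OF F that, of "\<lambda>_. 0"] by simp_all
  qed
  define L where "L = (\<lambda>j B. Re (trace (A ** H j ** B)))"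
  have L: "bounded_linear (L j)" for j
    unfolding L_def by (rule bounded_linear_compose[OF bounded_linear_Re_trace mmult.bounded_linear_right])
  have "Re (trace (A ** X \<omega> ** F \<omega>)) = (\<Sum>j\<in>{1..n}. L j (\<gamma> j \<omega> *\<^sub>R F \<omega>))" for \<omega>
    by (simp add: X L_def mmult.sum_left mmult.sum_right mmult.scaleR_left mmult.scaleR_right trace_sum)
  then have "expectation (\<lambda>\<omega>. Re (trace (A ** X \<omega> ** F \<omega>)))
      = (\<Sum>j\<in>{1..n}. expectation (\<lambda>\<omega>. L j (\<gamma> j \<omega> *\<^sub>R F \<omega>)))"
    by (simp add: integrable_bounded_linear[OF L int])
  also have "\<dots> = (\<Sum>j\<in>{1..n}. expectation (\<lambda>\<omega>. L j (D j \<omega>)))"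
    using stein_integrable(2)[OF F] int one
    by (intro sum.cong refl) (simp add: integral_bounded_linear[OF L])
  finally show ?thesis by (simp add: L_def)
qed

end

end

section \<open>The second-order inequality\<close>

lemma hermitian_sum_squares:
  assumes "\<And>i. i \<in> I \<Longrightarrow> hermitian_matrix (H i)"
  shows "hermitian_matrix (\<Sum>i\<in>I. H i ** H i)"
  using assms by (simp add: hermitian_matrix_def cadjoint_sum cadjoint_mult)

lemma sum_squares_spectral:
  fixes H :: "'i \<Rightarrow> complex^'d^'d"
  assumes H: "\<And>i. i \<in> I \<Longrightarrow> hermitian_matrix (H i)"
  obtains P v where "unitary_matrix P" "(\<Sum>i\<in>I. H i ** H i) = conj_rdiag P v" "\<And>k. 0 \<le> v k"
proof -
  obtain P and v :: "'d \<Rightarrow> real"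
    where P: "unitary_matrix P" and V: "(\<Sum>i\<in>I. H i ** H i) = conj_rdiag P v"
    using hermitian_sum_squares[of I H] H by (metis hermitian_spectral)
  have "0 \<le> v k" for k
  proof -
    have "(\<Sum>i\<in>I. cadjoint (H i ** P) ** (H i ** P)) = cadjoint P ** (\<Sum>i\<in>I. H i ** H i) ** P"
      using H by (simp add: mmult.sum_left mmult.sum_right cadjoint_mult matrix_mul_assoc hermitian_matrix_def)
    also have "\<dots> = diagm (\<lambda>k. complex_of_real (v k))"
      using P by (simp add: V conj_diag_def matrix_mul_assoc[symmetric] unitaryD)
    finally have "(\<Sum>i\<in>I. cadjoint (H i ** P) ** (H i ** P)) $ k $ k = of_real (v k)"
      by (simp add: diagm_def)
    then have "of_real (v k) = complex_of_real (\<Sum>i\<in>I. \<Sum>l\<in>UNIV. (cmod ((H i ** P) $ l $ k))\<^sup>2)"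
      unfolding sum_component gram_diag by simp
    then have "v k = (\<Sum>i\<in>I. \<Sum>l\<in>UNIV. (cmod ((H i ** P) $ l $ k))\<^sup>2)"
      by (simp only: of_real_eq_iff)
    then show ?thesis by (simp add: sum_nonneg)
  qed
  with P V show thesis by (rule that)
qed

lemma matrix_sigma_nonneg: "0 \<le> matrix_sigma q n H"
  by (simp add: matrix_sigma_def schatten_norm_nonneg)

lemma matrix_sigma_power:
  fixes H :: "nat \<Rightarrow> complex^'d^'d"
  assumes p: "0 < p" and P: "unitary_matrix P" and V: "(\<Sum>i\<in>{1..n}. H i ** H i) = conj_rdiag P v"
    and v: "\<And>k. 0 \<le> v k"
  shows "(\<Sum>k\<in>UNIV. v k ^ p) = (matrix_sigma (2 * real p) n H)\<^sup>2 ^ p"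
proof -
  have "\<bar>v k powr (1 / 2)\<bar> powr (2 * real p) = v k ^ p" for k
    using v[of k] p powr_realpow'[of "v k" p] by (simp add: powr_powr)
  then have "matrix_sigma (2 * real p) n H = (\<Sum>k\<in>UNIV. v k ^ p) powr (1 / (2 * real p))"
    unfolding matrix_sigma_def V psd_power_conj_rdiag[OF P] schatten_norm_conj_rdiag[OF P] by simp
  moreover have "((S powr (1 / (2 * real p)))\<^sup>2) ^ p = S" if "0 \<le> S" for S :: real
    using p that by (cases "S = 0") (simp_all add: powr_power flip: power_mult)
  moreover have "0 \<le> (\<Sum>k\<in>UNIV. v k ^ p)" using v by (simp add: sum_nonneg)
  ultimately show ?thesis by simp
qed

lemma power_powr_divide:
  fixes x :: real
  assumes "0 \<le> x" "b * real m = real k" "0 < k"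
  shows "(x ^ m) powr b = x ^ k"
proof (cases "x = 0")
  case True
  have "m \<noteq> 0" using assms(2,3) by (intro notI) simp
  then show ?thesis using True assms by (simp add: power_0_left)
next
  case False
  then have "0 < x" using assms by simp
  then show ?thesis using assms by (simp add: powr_powr mult.commute flip: powr_realpow)
qed

lemma trace_sum_squares_Holder:
  fixes H :: "nat \<Rightarrow> complex^'d^'d"
  assumes p: "3 \<le> p" and H: "\<And>i. i \<in> {1..n} \<Longrightarrow> hermitian_matrix (H i)"
    and X: "hermitian_matrix X"
  defines "\<sigma> \<equiv> matrix_sigma (2 * real p) n H" and "\<tau> \<equiv> Re (trace (mpow X (2 * p)))"
    and "V \<equiv> \<Sum>i\<in>{1..n}. H i ** H i"
  shows "Re (trace (V ** mpow X (2 * p - 2))) \<le> \<sigma>\<^sup>2 * \<tau> powr ((real p - 1) / real p)"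
    and "(\<Sum>i\<in>{1..n}. Re (trace (H i ** V ** H i ** mpow X (2 * p - 4))))
      \<le> \<sigma> ^ 4 * \<tau> powr ((real p - 2) / real p)"
proof -
  obtain P and v :: "'d \<Rightarrow> real"
    where P: "unitary_matrix P" and V: "V = conj_rdiag P v" and v: "\<And>k. 0 \<le> v k"
    unfolding V_def using sum_squares_spectral[of "{1..n}" H, OF H] by blast
  obtain U and x :: "'d \<Rightarrow> real" where U: "unitary_matrix U" and X: "X = conj_rdiag U x"
    using X by (rule hermitian_spectral)
  have Xpow: "mpow X (2 * m) = conj_rdiag U (\<lambda>k. \<bar>x k\<bar> ^ (2 * m))" for m
    unfolding X mpow_conj_diag[OF U] by (simp add: power_even_abs flip: of_real_power)
  have \<tau>: "\<tau> = (\<Sum>k\<in>UNIV. \<bar>x k\<bar> ^ (2 * p))"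
    unfolding \<tau>_def X by (rule trace_mpow_even_eq[OF U])
  have \<sigma>: "(\<Sum>k\<in>UNIV. v k ^ p) = \<sigma>\<^sup>2 ^ p"
    unfolding \<sigma>_def by (rule matrix_sigma_power[OF _ P V[unfolded V_def] v]) (use p in simp)
  have e2: "2 * p - 2 = 2 * (p - 1)" and e4: "2 * p - 4 = 2 * (p - 2)" by auto
  have rp: "real (p - 1) = real p - 1" "real (p - 2) = real p - 2" using p by (auto simp: of_nat_diff)
  show first: "Re (trace (V ** mpow X (2 * p - 2))) \<le> \<sigma>\<^sup>2 * \<tau> powr ((real p - 1) / real p)"
  proof -
    \<comment> \<open>A single index and the identity in place of H i reduce
      \<open>trace_Holder\<close> to Hoelder's inequality for the trace of a product.\<close>
    have "(\<Sum>i\<in>{()}. Re (trace (mat 1 ** conj_rdiag P (\<lambda>k. (v k ^ p) powr (1 / real p)) ** mat 1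
        ** conj_rdiag U (\<lambda>k. (\<bar>x k\<bar> ^ (2 * p)) powr ((real p - 1) / real p)))))
      \<le> (\<Sum>i\<in>{()}. Re (trace (mat 1 ** mat 1 ** conj_rdiag P (\<lambda>k. v k ^ p)))) powr (1 / real p)
        * (\<Sum>i\<in>{()}. Re (trace (mat 1 ** mat 1 ** conj_rdiag U (\<lambda>k. \<bar>x k\<bar> ^ (2 * p))))) powr ((real p - 1) / real p)"
      by (rule trace_Holder) (use p v in \<open>auto simp: hermitian_mat1 P U field_simps\<close>)
    moreover have "(v k ^ p) powr (1 / real p) = v k ^ 1" for k
      using p v by (intro power_powr_divide) auto
    moreover have "(\<bar>x k\<bar> ^ (2 * p)) powr ((real p - 1) / real p) = \<bar>x k\<bar> ^ (2 * (p - 1))" for k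
      using p by (intro power_powr_divide) (auto simp: rp)
    moreover have "(\<sigma>\<^sup>2 ^ p) powr (1 / real p) = \<sigma>\<^sup>2 ^ 1"
      using p by (intro power_powr_divide) auto
    ultimately show ?thesis
      unfolding V e2 Xpow \<tau> by (simp add: Re_trace_conj_rdiag[OF P] Re_trace_conj_rdiag[OF U] \<sigma> del: of_real_power)
  qed
  show "(\<Sum>i\<in>{1..n}. Re (trace (H i ** V ** H i ** mpow X (2 * p - 4))))
      \<le> \<sigma> ^ 4 * \<tau> powr ((real p - 2) / real p)"
  proof -
    \<comment> \<open>Hoelder's inequality is applied to V^(p-1) and X^(2p-2) with these exponents:
      the first factor collapses to tr V^p, and the second contains the trace bounded in
      \<open>first\<close>. The powers of \<sigma>^2 add up to p a + b = 2.\<close>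
    define a where "a = 1 / (real p - 1)"
    define b where "b = (real p - 2) / (real p - 1)"
    have ab: "0 < a" "0 < b" "a + b = 1" using p by (auto simp: a_def b_def field_simps)
    have "(\<Sum>i\<in>{1..n}. Re (trace (H i ** conj_rdiag P (\<lambda>k. (v k ^ (p - 1)) powr a) ** H i
        ** conj_rdiag U (\<lambda>k. (\<bar>x k\<bar> ^ (2 * (p - 1))) powr b))))
      \<le> (\<Sum>i\<in>{1..n}. Re (trace (H i ** H i ** conj_rdiag P (\<lambda>k. v k ^ (p - 1))))) powr a
        * (\<Sum>i\<in>{1..n}. Re (trace (H i ** H i ** conj_rdiag U (\<lambda>k. \<bar>x k\<bar> ^ (2 * (p - 1)))))) powr b"
      by (rule trace_Holder[OF H _ P U ab]) (use v in auto)
    moreover have "(v k ^ (p - 1)) powr a = v k ^ 1" for k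
      using p v by (intro power_powr_divide) (auto simp: a_def rp)
    moreover have "(\<bar>x k\<bar> ^ (2 * (p - 1))) powr b = \<bar>x k\<bar> ^ (2 * (p - 2))" for k
    proof (rule power_powr_divide)
      have "3 \<le> real p" using p by simp
      then show "b * real (2 * (p - 1)) = real (2 * (p - 2))" by (simp add: b_def rp field_simps)
    qed (use p in auto)
    moreover have "(\<Sum>i\<in>{1..n}. Re (trace (H i ** H i ** conj_rdiag P (\<lambda>k. v k ^ (p - 1))))) = \<sigma>\<^sup>2 ^ p"
    proof -
      have "(\<Sum>i\<in>{1..n}. Re (trace (H i ** H i ** conj_rdiag P (\<lambda>k. v k ^ (p - 1)))))
          = Re (trace (V ** conj_rdiag P (\<lambda>k. v k ^ (p - 1))))"
        by (simp add: V_def mmult.sum_left trace_sum)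
      also have "V ** conj_rdiag P (\<lambda>k. v k ^ (p - 1)) = conj_rdiag P (\<lambda>k. v k ^ p)"
        unfolding V conj_diag_mult[OF P] using p by (simp add: power_eq_if[of _ p])
      finally show ?thesis unfolding Re_trace_conj_rdiag[OF P] \<sigma> .
    qed
    moreover have "(\<Sum>i\<in>{1..n}. Re (trace (H i ** H i ** conj_rdiag U (\<lambda>k. \<bar>x k\<bar> ^ (2 * (p - 1))))))
        = Re (trace (V ** mpow X (2 * p - 2)))"
      unfolding e2 Xpow by (simp add: V_def mmult.sum_left trace_sum)
    ultimately have "(\<Sum>i\<in>{1..n}. Re (trace (H i ** V ** H i ** mpow X (2 * p - 4))))
        \<le> (\<sigma>\<^sup>2 ^ p) powr a * Re (trace (V ** mpow X (2 * p - 2))) powr b"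
      unfolding V e4 Xpow by simp
    also have "\<dots> \<le> (\<sigma>\<^sup>2 ^ p) powr a * (\<sigma>\<^sup>2 * \<tau> powr ((real p - 1) / real p)) powr b"
    proof (intro mult_left_mono powr_mono2 first)
      show "0 \<le> Re (trace (V ** mpow X (2 * p - 2)))"
      proof -
        have "Re (trace (mat 1 ** conj_rdiag P v ** mat 1 ** conj_rdiag U (\<lambda>k. \<bar>x k\<bar> ^ (2 * (p - 1))))) \<ge> 0"
          unfolding trace_sandwich[OF hermitian_mat1] using v by (auto intro!: sum_nonneg)
        then show ?thesis unfolding V e2 Xpow by simp
      qed
    qed (use ab in auto)
    also have "\<dots> = ((\<sigma>\<^sup>2 ^ p) powr a * \<sigma>\<^sup>2 powr b) * \<tau> powr ((real p - 2) / real p)"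
      using p by (simp add: powr_mult powr_powr b_def)
    also have "(\<sigma>\<^sup>2 ^ p) powr a * \<sigma>\<^sup>2 powr b = \<sigma> ^ 4"
    proof (cases "\<sigma> = 0")
      case False
      then have pos: "0 < \<sigma>\<^sup>2" by simp
      have "(\<sigma>\<^sup>2 ^ p) powr a * \<sigma>\<^sup>2 powr b = \<sigma>\<^sup>2 powr (real p * a + b)"
        using pos by (simp add: powr_powr powr_add flip: powr_realpow)
      also have "real p * a + b = (2 * (real p - 1)) / (real p - 1)"
        by (simp add: a_def b_def add_divide_distrib[symmetric])
      also have "\<dots> = real 2"
        using p by (subst nonzero_mult_div_cancel_right) auto
      also have "\<sigma>\<^sup>2 powr real 2 = \<sigma> ^ 4" unfolding powr_realpow[OF pos] by simp
      finally show ?thesis .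
    qed (use p in simp)
    finally show ?thesis .
  qed
qed

lemma trace_power_split_le:
  fixes H :: "nat \<Rightarrow> complex^'d^'d"
  assumes p: "3 \<le> p" and H: "\<And>i. i \<in> {1..n} \<Longrightarrow> hermitian_matrix (H i)"
    and X: "hermitian_matrix X"
  shows "(\<Sum>r\<le>2 * p - 2. \<Sum>i\<in>{1..n}. Re (trace (H i ** mpow X r ** H i ** mpow X (2 * p - 2 - r))))
    \<le> 3 * Re (trace ((\<Sum>i\<in>{1..n}. H i ** H i) ** mpow X (2 * p - 2)))
      + (2 * real p - 4) * (\<Sum>i\<in>{1..n}. Re (trace (H i ** mpow X 2 ** H i ** mpow X (2 * p - 4))))"
proof -
  obtain U and x :: "'d \<Rightarrow> real" where U: "unitary_matrix U" and X: "X = conj_rdiag U x"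
    using X by (rule hermitian_spectral)
  define c where "c = (\<lambda>k l. \<Sum>i\<in>{1..n}. (cmod ((cadjoint U ** H i ** U) $ k $ l))\<^sup>2)"
  define T where "T = (\<lambda>r. \<Sum>k\<in>UNIV. \<Sum>l\<in>UNIV. c k l * (x l ^ r * x k ^ (2 * p - 2 - r)))"
  have T: "(\<Sum>i\<in>{1..n}. Re (trace (H i ** mpow X r ** H i ** mpow X (2 * p - 2 - r)))) = T r" for r
  proof -
    have "(\<Sum>i\<in>{1..n}. Re (trace (H i ** mpow X r ** H i ** mpow X (2 * p - 2 - r))))
      = (\<Sum>i\<in>{1..n}. \<Sum>(k, l)\<in>UNIV. (cmod ((cadjoint U ** H i ** U) $ k $ l))\<^sup>2 * (x l ^ r * x k ^ (2 * p - 2 - r)))"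
      unfolding X mpow_conj_diag[OF U] of_real_power[symmetric]
      by (intro sum.cong refl trace_sandwich H)
    also have "\<dots> = (\<Sum>(k, l)\<in>UNIV. c k l * (x l ^ r * x k ^ (2 * p - 2 - r)))"
      by (subst sum.swap) (simp add: c_def sum_distrib_right case_prod_unfold)
    also have "\<dots> = T r"
      unfolding T_def sum.cartesian_product UNIV_Times_UNIV ..
    finally show ?thesis .
  qed
  have sym: "c k l = c l k" for k l
  proof -
    have "cmod ((cadjoint U ** H i ** U) $ k $ l) = cmod ((cadjoint U ** H i ** U) $ l $ k)" if "i \<in> {1..n}" for i
    proof -
      have "cadjoint (cadjoint U ** H i ** U) = cadjoint U ** H i ** U"
        using H[OF that] by (simp add: cadjoint_mult hermitian_matrix_def matrix_mul_assoc)
      then show ?thesis by (metis cadjoint_component complex_mod_cnj)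
    qed
    then show ?thesis by (simp add: c_def)
  qed
  have "(\<Sum>r\<le>2 * p - 2. T r) \<le> 3 * T 0 + (2 * real p - 4) * T 2"
    unfolding T_def by (rule sum_monomials_le[OF p _ sym]) (simp add: c_def sum_nonneg)
  moreover have "T 0 = Re (trace ((\<Sum>i\<in>{1..n}. H i ** H i) ** mpow X (2 * p - 2)))"
    unfolding T[symmetric] by (simp add: mmult.sum_left trace_sum)
  moreover have "2 * p - 2 - 2 = 2 * p - 4" by simp
  ultimately show ?thesis unfolding T[symmetric] by simp
qed

text \<open>The left-hand side is what the second integration by parts produces. When the derivative
  hits the second X of X^2, two letters H_j become neighbours and sum to V. When it hits one of the
  2p - 4 factors of X^s, a crossing term arises, whose neighbouring letters H_i H_j put
  \<open>mat 1\<close> in the first slot.\<close>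

lemma trace_second_order_le:
  fixes H :: "nat \<Rightarrow> complex^'d^'d"
  assumes p: "3 \<le> p" and H: "\<And>i. i \<in> {1..n} \<Longrightarrow> hermitian_matrix (H i)"
    and X: "hermitian_matrix X"
  defines "\<sigma> \<equiv> matrix_sigma (2 * real p) n H" and "w \<equiv> matrix_w (2 * real p) n H"
    and "s \<equiv> 2 * p - 4"
  shows "(\<Sum>i\<in>{1..n}. \<Sum>j\<in>{1..n}. Re (trace (H i ** H j ** (H j ** (H i ** mpow X s)
      + X ** (H i ** (\<Sum>r<s. mpow X r ** H j ** mpow X (s - 1 - r)))))))
    \<le> (\<sigma> ^ 4 + (2 * real p - 4) * w ^ 4) * Re (trace (mpow X (2 * p))) powr ((real p - 2) / real p)"
proof -
  define V where "V = (\<Sum>i\<in>{1..n}. H i ** H i)"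
  define \<theta> where "\<theta> = Re (trace (mpow X (2 * p))) powr ((real p - 2) / real p)"
  have "(\<Sum>i\<in>{1..n}. \<Sum>j\<in>{1..n}. Re (trace (H i ** H j ** (H j ** (H i ** mpow X s)
      + X ** (H i ** (\<Sum>r<s. mpow X r ** H j ** mpow X (s - 1 - r)))))))
    = (\<Sum>i\<in>{1..n}. \<Sum>j\<in>{1..n}. Re (trace (H i ** (H j ** H j) ** H i ** mpow X s)))
      + (\<Sum>i\<in>{1..n}. \<Sum>j\<in>{1..n}. \<Sum>r<s. Re (trace (H i ** mat 1 ** H j ** X ** H i ** mpow X r ** H j ** mpow X (s - 1 - r))))"
    by (simp add: mmult.add_right mmult.sum_right trace_add trace_sum sum.distrib matrix_mul_assoc)
  also have "(\<Sum>i\<in>{1..n}. \<Sum>j\<in>{1..n}. Re (trace (H i ** (H j ** H j) ** H i ** mpow X s)))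
      = (\<Sum>i\<in>{1..n}. Re (trace (H i ** V ** H i ** mpow X s)))"
    by (simp add: V_def mmult.sum_left mmult.sum_right trace_sum)
  also have "\<dots> \<le> \<sigma> ^ 4 * \<theta>"
    unfolding V_def \<sigma>_def \<theta>_def s_def by (rule trace_sum_squares_Holder(2)[OF p H X])
  also have "(\<Sum>i\<in>{1..n}. \<Sum>j\<in>{1..n}. \<Sum>r<s. Re (trace (H i ** mat 1 ** H j ** X ** H i ** mpow X r ** H j ** mpow X (s - 1 - r))))
      = (\<Sum>r<s. Re (cross_trace n H (mat 1) X (mpow X r) (mpow X (s - 1 - r))))"
    unfolding cross_trace_def
    by (simp add: sum.swap[of _ "{..<s}"])
  also have "\<dots> \<le> (\<Sum>r<s. w ^ 4 * \<theta>)"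
  proof (rule sum_mono)
    fix r assume "r \<in> {..<s}"
    then have "r \<le> 2 * p - 5" "s - 1 - r = 2 * p - 5 - r" using p by (auto simp: s_def)
    with cross_trace_powers[OF p this(1) X, of n H]
    show "Re (cross_trace n H (mat 1) X (mpow X r) (mpow X (s - 1 - r))) \<le> w ^ 4 * \<theta>"
      unfolding w_def \<theta>_def by (metis complex_Re_le_cmod order_trans)
  qed
  also have "\<dots> = (2 * real p - 4) * w ^ 4 * \<theta>"
    using p by (simp add: s_def of_nat_diff)
  finally show ?thesis by (simp add: \<theta>_def algebra_simps)
qed

text \<open>Jensen's inequality for the concave power t, through its tangent at the mean: Young's
  inequality with second factor 1 is this tangent bound.\<close>

lemma (in prob_space) expectation_le_powr:
  fixes f g :: "'a \<Rightarrow> real"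
  assumes f: "integrable M f" and g: "integrable M g" "\<And>\<omega>. 0 \<le> g \<omega>"
    and le: "\<And>\<omega>. f \<omega> \<le> K * g \<omega> powr t" and K: "0 \<le> K" and t: "0 < t" "t < 1"
    and pos: "0 < expectation g"
  shows "expectation f \<le> K * expectation g powr t"
proof -
  define T where "T = expectation g"
  have T: "0 < T" using pos by (simp add: T_def)
  have "f \<omega> \<le> K * T powr t * (t * (g \<omega> / T) + (1 - t))" for \<omega>
  proof -
    have "g \<omega> powr t = T powr t * ((g \<omega> / T) powr t * 1 powr (1 - t))"
      using T g(2)[of \<omega>] by (simp add: powr_divide)
    also have "\<dots> \<le> T powr t * (t * (g \<omega> / T) + (1 - t) * 1)"
      using T g(2)[of \<omega>] t by (intro mult_left_mono Young_powr) auto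
    finally have "K * g \<omega> powr t \<le> K * (T powr t * (t * (g \<omega> / T) + (1 - t)))"
      using K by (intro mult_left_mono) auto
    with le[of \<omega>] show ?thesis by (simp add: mult.assoc)
  qed
  then have "expectation f \<le> expectation (\<lambda>\<omega>. K * T powr t * (t * (g \<omega> / T) + (1 - t)))"
    using f g by (intro integral_mono) auto
  also have "\<dots> = K * T powr t * (t * (T / T) + (1 - t))"
    using g by (simp add: T_def prob_space)
  also have "\<dots> = K * T powr t" using T by simp
  finally show ?thesis by (simp add: T_def)
qed

text \<open>Division by T^((p-2)/p) leaves a quadratic inequality in m^2 with m = T^(1/(2p)). If m
  exceeded the claimed bound, the product of m^2 and m^2 - 3 \<sigma>^2 would be too large for
  it.\<close>

lemma moment_inequality_solve:
  fixes T \<sigma> w :: real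
  assumes p: "3 \<le> p" and T: "0 < T" and \<sigma>: "0 \<le> \<sigma>" and w: "0 \<le> w"
    and le: "T \<le> 3 * (\<sigma>\<^sup>2 * T powr ((real p - 1) / real p)) + (2 * real p - 4)
      * ((\<sigma> ^ 4 + (2 * real p - 4) * w ^ 4) * T powr ((real p - 2) / real p))"
  shows "T powr (1 / (2 * real p)) \<le> 3 * (2 * real p - 5) powr (1/4) * \<sigma> + sqrt (2 * real p - 4) * w"
proof (rule ccontr)
  define m where "m = T powr (1 / (2 * real p))"
  define b where "b = 2 * real p - 4"
  define c where "c = (2 * real p - 5) powr (1/4)"
  assume "\<not> ?thesis"
  then have m: "3 * c * \<sigma> + sqrt b * w < m" by (simp add: m_def b_def c_def)
  have m0: "0 < m" using T by (simp add: m_def)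
  have b: "0 \<le> b" using p by (simp add: b_def)
  have c: "1 \<le> c" using p by (simp add: c_def ge_one_powr_ge_zero)
  have "c ^ 4 = 2 * real p - 5" using p by (simp add: c_def powr_power)
  \<comment> \<open>2p - 4 \<le> 2 (2p - 5) is exactly p \<ge> 3.\<close>
  then have bc: "b \<le> 2 * c ^ 4" using p by (simp add: b_def)
  define Q where "Q = T powr ((real p - 2) / real p)"
  have Q: "0 < Q" using T by (simp add: Q_def)
  have T_eqs: "T powr ((real p - 1) / real p) = m ^ 2 * Q" "m ^ 4 * Q = T"
    using T p by (simp_all add: m_def Q_def powr_power powr_divide powr_add[symmetric] field_simps)
  have "m ^ 4 * Q \<le> 3 * (\<sigma>\<^sup>2 * (m ^ 2 * Q)) + b * ((\<sigma> ^ 4 + b * w ^ 4) * Q)"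
    unfolding T_eqs(2) using le by (simp only: T_eqs(1) Q_def[symmetric] b_def[symmetric])
  then have "m ^ 4 * Q \<le> (3 * \<sigma>\<^sup>2 * m ^ 2 + b * (\<sigma> ^ 4 + b * w ^ 4)) * Q"
    by (simp add: algebra_simps)
  then have m4: "m ^ 4 \<le> 3 * \<sigma>\<^sup>2 * m\<^sup>2 + b * (\<sigma> ^ 4 + b * w ^ 4)"
    using Q by simp
  have "(3 * c * \<sigma> + sqrt b * w)\<^sup>2 < m\<^sup>2"
    using m \<sigma> w b c by (intro power_strict_mono) auto
  moreover have "9 * c\<^sup>2 * \<sigma>\<^sup>2 + b * w\<^sup>2 \<le> (3 * c * \<sigma> + sqrt b * w)\<^sup>2"
    using \<sigma> w b c by (simp add: power2_sum power_mult_distrib)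
  ultimately have A: "9 * c\<^sup>2 * \<sigma>\<^sup>2 + b * w\<^sup>2 < m\<^sup>2" by simp
  \<comment> \<open>Since c \<ge> 1, subtracting 3 \<sigma>^2 costs at most 3 of the 9 in front of
    c^2 \<sigma>^2.\<close>
  have "\<sigma>\<^sup>2 \<le> c\<^sup>2 * \<sigma>\<^sup>2" using c by (simp add: mult_le_cancel_right1)
  with A have B: "6 * c\<^sup>2 * \<sigma>\<^sup>2 + b * w\<^sup>2 < m\<^sup>2 - 3 * \<sigma>\<^sup>2" by linarith
  have "(9 * c\<^sup>2 * \<sigma>\<^sup>2 + b * w\<^sup>2) * (6 * c\<^sup>2 * \<sigma>\<^sup>2 + b * w\<^sup>2) < m\<^sup>2 * (m\<^sup>2 - 3 * \<sigma>\<^sup>2)"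
    using A B b m0 by (intro mult_strict_mono) (auto intro!: add_nonneg_nonneg)
  also have "\<dots> \<le> b * \<sigma> ^ 4 + b\<^sup>2 * w ^ 4"
    using m4 by (simp add: algebra_simps power2_eq_square power4_eq_xxxx)
  also have "\<dots> \<le> 2 * c ^ 4 * \<sigma> ^ 4 + b\<^sup>2 * w ^ 4"
    using bc by (intro add_mono mult_right_mono) auto
  also have "\<dots> \<le> (9 * c\<^sup>2 * \<sigma>\<^sup>2 + b * w\<^sup>2) * (6 * c\<^sup>2 * \<sigma>\<^sup>2 + b * w\<^sup>2)"
  proof -
    have "(9 * c\<^sup>2 * \<sigma>\<^sup>2 + b * w\<^sup>2) * (6 * c\<^sup>2 * \<sigma>\<^sup>2 + b * w\<^sup>2)
        = 2 * c ^ 4 * \<sigma> ^ 4 + b\<^sup>2 * w ^ 4 + (52 * c ^ 4 * \<sigma> ^ 4 + 15 * (b * c\<^sup>2 * \<sigma>\<^sup>2 * w\<^sup>2))"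
      by (simp add: algebra_simps power2_eq_square power4_eq_xxxx)
    moreover have "0 \<le> 52 * c ^ 4 * \<sigma> ^ 4 + 15 * (b * c\<^sup>2 * \<sigma>\<^sup>2 * w\<^sup>2)" using b by simp
    ultimately show ?thesis by linarith
  qed
  finally show False by simp
qed

theorem theorem3p5:
  fixes M :: "'a measure"
    and n p :: nat
    and H :: "nat \<Rightarrow> complex^'d^'d"
    and \<gamma> :: "nat \<Rightarrow> 'a \<Rightarrow> real"
    and X :: "'a \<Rightarrow> complex^'d^'d"
  assumes "prob_space M"
    and "\<And>i. i \<in> {1..n} \<Longrightarrow> hermitian_matrix (H i)"
    and "prob_space.indep_vars M (\<lambda>_. borel) \<gamma> {1..n}"
    and "\<And>i. i \<in> {1..n} \<Longrightarrow> distributed M lborel (\<gamma> i) std_normal_density"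
    and "\<And>\<omega>. X \<omega> = (\<Sum>i\<in>{1..n}. \<gamma> i \<omega> *\<^sub>R H i)"
    and "p \<ge> 3"
  shows "(prob_space.expectation M (\<lambda>\<omega>. schatten_norm (2 * real p) (X \<omega>) ^ (2 * p)))
           powr (1 / (2 * real p))
         \<le> 3 * (2 * real p - 5) powr (1/4) * matrix_sigma (2 * real p) n H
           + sqrt (2 * real p - 4) * matrix_w (2 * real p) n H"
proof -
  interpret std_gaussian_family M n \<gamma>
    using assms by (simp add: std_gaussian_family_def std_gaussian_family_axioms_def)
  note H = assms(2) and X = assms(5) and p = assms(6)
  define \<sigma> where "\<sigma> = matrix_sigma (2 * real p) n H"
  define w where "w = matrix_w (2 * real p) n H"
  define \<tau> where "\<tau> = (\<lambda>\<omega>. Re (trace (mpow (X \<omega>) (2 * p))))"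
  define V where "V = (\<Sum>i\<in>{1..n}. H i ** H i)"
  define s where "s = 2 * p - 4"
  define T where "T = expectation \<tau>"
  have \<sigma>0: "0 \<le> \<sigma>" unfolding \<sigma>_def by (rule matrix_sigma_nonneg)
  have w0: "0 \<le> w" unfolding w_def by (rule matrix_w_nonneg) (use p in simp)
  have herm: "hermitian_matrix (X \<omega>)" for \<omega>
    using H by (simp add: hermitian_matrix_def X cadjoint_sum) (simp add: vec_eq_iff)
  have \<tau>: "schatten_norm (2 * real p) (X \<omega>) ^ (2 * p) = \<tau> \<omega>" "0 \<le> \<tau> \<omega>" for \<omega>
    using schatten_norm_even_power[OF herm, of p \<omega>] p by (simp_all add: \<tau>_def)
  have int_pow: "integrable M (\<lambda>\<omega>. Re (trace (A ** mpow (X \<omega>) k)))" for A k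
    by (rule integrable_Re_trace[OF stein_integrable(1)[OF stein_mpow[OF X]]])
  have int_\<tau>: "integrable M \<tau>"
    using int_pow[of "mat 1" "2 * p"] by (simp add: \<tau>_def)

  define t0 where "t0 = (\<lambda>\<omega>. Re (trace (V ** mpow (X \<omega>) (2 * p - 2))))"
  define t2 where "t2 = (\<lambda>\<omega>. \<Sum>i\<in>{1..n}. Re (trace (H i ** mpow (X \<omega>) 2 ** H i ** mpow (X \<omega>) s)))"
  define D where "D = (\<lambda>k j \<omega>. \<Sum>r<k. mpow (X \<omega>) r ** H j ** mpow (X \<omega>) (k - 1 - r))"
  have stein_pow: "stein (\<lambda>\<omega>. mpow (X \<omega>) k) (D k)" for k
    using stein_mpow[OF X] by (simp add: D_def)
  \<comment> \<open>One factor X of X^2 is reserved for the second integration by parts; F i is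
    everything to its right, and E i is the derivative of F i.\<close>
  define F where "F = (\<lambda>i \<omega>. X \<omega> ** (H i ** mpow (X \<omega>) s))"
  define E where "E = (\<lambda>i j \<omega>. H j ** (H i ** mpow (X \<omega>) s) + X \<omega> ** (H i ** D s j \<omega>))"
  have stein_F: "stein (F i) (E i)" for i
    unfolding F_def E_def by (intro stein_X_mult[OF X] stein_left_mult stein_pow)
  have int_t0: "integrable M t0" unfolding t0_def by (rule int_pow)
  have t2: "Re (trace (H i ** mpow (X \<omega>) 2 ** H i ** mpow (X \<omega>) s)) = Re (trace (H i ** X \<omega> ** F i \<omega>))" for i \<omega>
    by (simp add: F_def numeral_2_eq_2 matrix_mul_assoc)
  have int_XF: "integrable M (\<lambda>\<omega>. Re (trace (H i ** X \<omega> ** F i \<omega>)))" for i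
    using integrable_Re_trace[OF stein_integrable(1)[OF stein_X_mult[OF X stein_F]]]
    by (simp add: matrix_mul_assoc)
  have int_t2: "integrable M t2"
    unfolding t2_def t2 by (intro Bochner_Integration.integrable_sum int_XF)

  \<comment> \<open>The two integrands differ pointwise and agree in expectation; the bound by
    \<sigma> and w holds pointwise for the second one.\<close>
  have Et2: "expectation t2 = expectation (\<lambda>\<omega>. \<Sum>i\<in>{1..n}. \<Sum>j\<in>{1..n}. Re (trace (H i ** H j ** E i j \<omega>)))"
    and int_E: "integrable M (\<lambda>\<omega>. \<Sum>i\<in>{1..n}. \<Sum>j\<in>{1..n}. Re (trace (H i ** H j ** E i j \<omega>)))"
  proof -
    have int: "integrable M (\<lambda>\<omega>. Re (trace (H i ** H j ** E i j \<omega>)))" if "j \<in> {1..n}" for i j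
      by (rule integrable_Re_trace[OF stein_integrable(2)[OF stein_F that]])
    show "integrable M (\<lambda>\<omega>. \<Sum>i\<in>{1..n}. \<Sum>j\<in>{1..n}. Re (trace (H i ** H j ** E i j \<omega>)))"
      by (intro Bochner_Integration.integrable_sum int)
    have "expectation (\<lambda>\<omega>. \<Sum>i\<in>{1..n}. \<Sum>j\<in>{1..n}. Re (trace (H i ** H j ** E i j \<omega>)))
        = (\<Sum>i\<in>{1..n}. expectation (\<lambda>\<omega>. \<Sum>j\<in>{1..n}. Re (trace (H i ** H j ** E i j \<omega>))))"
      by (intro Bochner_Integration.integral_sum Bochner_Integration.integrable_sum int)
    also have "\<dots> = (\<Sum>i\<in>{1..n}. \<Sum>j\<in>{1..n}. expectation (\<lambda>\<omega>. Re (trace (H i ** H j ** E i j \<omega>))))"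
      by (intro sum.cong refl Bochner_Integration.integral_sum int)
    also have "\<dots> = expectation t2"
      unfolding t2_def t2
      by (simp only: Bochner_Integration.integral_sum[OF int_XF] expectation_trace_X[OF X stein_F])
    finally show "expectation t2 = expectation (\<lambda>\<omega>. \<Sum>i\<in>{1..n}. \<Sum>j\<in>{1..n}. Re (trace (H i ** H j ** E i j \<omega>)))" ..
  qed

  have T_le: "T \<le> 3 * expectation t0 + (2 * real p - 4) * expectation t2"
  proof -
    \<comment> \<open>One factor X is split off for the first integration by parts; the derivative
      of the remaining 2p - 1 factors gives the exponents r \<le> 2p - 2.\<close>
    have "\<tau> \<omega> = Re (trace (mat 1 ** X \<omega> ** mpow (X \<omega>) (2 * p - 1)))" for \<omega>
    proof -
      have "2 * p = Suc (2 * p - 1)" using p by simp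
      then show ?thesis unfolding \<tau>_def by (metis mpow.simps(2) matrix_mul_lid)
    qed
    then have "T = (\<Sum>j\<in>{1..n}. expectation (\<lambda>\<omega>. Re (trace (mat 1 ** H j ** D (2 * p - 1) j \<omega>))))"
      unfolding T_def expectation_trace_X[OF X stein_pow, symmetric]
      by (intro arg_cong[of _ _ expectation] ext)
    also have "\<dots> = expectation (\<lambda>\<omega>. \<Sum>j\<in>{1..n}. Re (trace (mat 1 ** H j ** D (2 * p - 1) j \<omega>)))"
      by (intro Bochner_Integration.integral_sum[symmetric] integrable_Re_trace
          stein_integrable(2)[OF stein_pow])
    also have "\<dots> \<le> expectation (\<lambda>\<omega>. 3 * t0 \<omega> + (2 * real p - 4) * t2 \<omega>)"
    proof (rule integral_mono)
      show "integrable M (\<lambda>\<omega>. \<Sum>j\<in>{1..n}. Re (trace (mat 1 ** H j ** D (2 * p - 1) j \<omega>)))"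
        by (intro Bochner_Integration.integrable_sum integrable_Re_trace stein_integrable(2)[OF stein_pow])
      show "integrable M (\<lambda>\<omega>. 3 * t0 \<omega> + (2 * real p - 4) * t2 \<omega>)"
        using int_t0 int_t2 by simp
      fix \<omega>
      have "{..<2 * p - 1} = {..2 * p - 2}" using p by auto
      then have "(\<Sum>j\<in>{1..n}. Re (trace (mat 1 ** H j ** D (2 * p - 1) j \<omega>)))
          = (\<Sum>j\<in>{1..n}. \<Sum>r\<le>2 * p - 2. Re (trace (H j ** mpow (X \<omega>) r ** H j ** mpow (X \<omega>) (2 * p - 2 - r))))"
        by (simp add: D_def mmult.sum_right trace_sum matrix_mul_assoc numeral_2_eq_2)
      also have "\<dots> = (\<Sum>r\<le>2 * p - 2. \<Sum>j\<in>{1..n}. Re (trace (H j ** mpow (X \<omega>) r ** H j ** mpow (X \<omega>) (2 * p - 2 - r))))"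
        by (rule sum.swap)
      also have "\<dots> \<le> 3 * t0 \<omega> + (2 * real p - 4) * t2 \<omega>"
        unfolding t0_def t2_def V_def s_def by (rule trace_power_split_le[OF p H herm])
      finally show "(\<Sum>j\<in>{1..n}. Re (trace (mat 1 ** H j ** D (2 * p - 1) j \<omega>)))
          \<le> 3 * t0 \<omega> + (2 * real p - 4) * t2 \<omega>" .
    qed
    also have "\<dots> = 3 * expectation t0 + (2 * real p - 4) * expectation t2"
      using int_t0 int_t2 by simp
    finally show ?thesis .
  qed

  have "T powr (1 / (2 * real p)) \<le> 3 * (2 * real p - 5) powr (1/4) * \<sigma> + sqrt (2 * real p - 4) * w"
  proof (cases "0 < T")
    \<comment> \<open>Jensen's inequality and the division by a power of T need T > 0. For T = 0 the
      left-hand side is 0, as 0 powr x = 0.\<close>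
    case False
    moreover have "0 \<le> T" unfolding T_def by (intro Bochner_Integration.integral_nonneg \<tau>)
    ultimately show ?thesis using \<sigma>0 w0 p by simp
  next
    case True
    note pos = True[unfolded T_def]
    have "expectation t0 \<le> \<sigma>\<^sup>2 * T powr ((real p - 1) / real p)"
      unfolding T_def
    proof (rule expectation_le_powr[OF int_t0 int_\<tau> \<tau>(2) _ _ _ _ pos])
      show "t0 \<omega> \<le> \<sigma>\<^sup>2 * \<tau> \<omega> powr ((real p - 1) / real p)" for \<omega>
        unfolding t0_def V_def \<sigma>_def \<tau>_def by (rule trace_sum_squares_Holder(1)[OF p H herm])
    qed (use p in auto)
    moreover have "expectation t2 \<le> (\<sigma> ^ 4 + (2 * real p - 4) * w ^ 4) * T powr ((real p - 2) / real p)"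
      unfolding T_def Et2
    proof (rule expectation_le_powr[OF int_E int_\<tau> \<tau>(2) _ _ _ _ pos])
      show "(\<Sum>i\<in>{1..n}. \<Sum>j\<in>{1..n}. Re (trace (H i ** H j ** E i j \<omega>)))
          \<le> (\<sigma> ^ 4 + (2 * real p - 4) * w ^ 4) * \<tau> \<omega> powr ((real p - 2) / real p)" for \<omega>
        unfolding E_def D_def \<sigma>_def w_def \<tau>_def s_def by (rule trace_second_order_le[OF p H herm])
    qed (use p \<sigma>0 w0 in auto)
    ultimately have "T \<le> 3 * (\<sigma>\<^sup>2 * T powr ((real p - 1) / real p)) + (2 * real p - 4)
        * ((\<sigma> ^ 4 + (2 * real p - 4) * w ^ 4) * T powr ((real p - 2) / real p))"
      using p by (intro order_trans[OF T_le] add_mono mult_left_mono) auto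
    then show ?thesis by (rule moment_inequality_solve[OF p True \<sigma>0 w0])
  qed
  then show ?thesis by (simp add: \<tau>(1) T_def \<sigma>_def w_def)
qed

end
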